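(* Let $\mathbb{G}$ be a homogeneous group of homogeneous dimension $Q\ge2$, let $|\cdot|$ be a homogeneous quasi-norm on $\mathbb{G}$, and let $\mathcal{R}$ be the associated radial derivative operator. Let $1<p<Q$ and $\frac1p+\frac1q=1$. Then for every complex-valued function $f\in C_0^\infty(\mathbb{G}\setminus\{0\})$, $$\left(\int_{\mathbb{G}}|\mathcal{R}f|^p\,dx\right)^{1/p}\left(\int_{\mathbb{G}}|x|^q|f|^q\,dx\right)^{1/q}\ge\frac{Q-p}{p}\int_{\mathbb{G}}|f|^2\,dx .$$
   Context: A homogeneous group $\mathbb{G}$ is a connected, simply connected Lie group whose Lie algebra $\mathfrak{g}$ is equipped with a family of dilations $D_\lambda=\mathrm{Exp}(A\ln\lambda)=\sum_{k\ge0}\frac{1}{k!}(\ln(\lambda)A)^k$, $\lambda>0$, where $A$ is a diagonalisable linear operator on $\mathfrak{g}$ with positive eigenvalues and each $D_\lambda$ is a Lie algebra morphism. Such a group is nilpotent and the exponential map $\exp_{\mathbb{G}}:\mathfrak{g}\to\mathbb{G}$ is a global diffeomorphism; it transports the dilations to $\mathbb{G}$, where they are written $D_\lambda x$ or $\lambda x$, i.e. $D_\lambda(\exp_{\mathbb{G}}X)=\exp_{\mathbb{G}}(D_\lambda X)$. The homogeneous dimension is $Q=\mathrm{Tr}\,A$. The identity element of $\mathbb{G}$ is denoted $0$, and $dx$ denotes Haar measure on $\mathbb{G}$. A homogeneous quasi-norm is a continuous function $|\cdot|:\mathbb{G}\to[0,\infty)$ with $|x^{-1}|=|x|$ for all $x\in\mathbb{G}$,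 $|\lambda x|=\lambda|x|$ for all $x\in\mathbb{G}$, $\lambda>0$, and $|x|=0$ if and only if $x=0$. The operator $\mathcal{R}=\frac{d}{d|x|}$ is the radial derivative: for $x\neq 0$, writing $x=D_{\rho}y$ with $\rho=|x|$ and $|y|=1$, $\mathcal{R}f(x)=\frac{d}{dr}f(D_r y)\big|_{r=\rho}$. $C_0^\infty(\mathbb{G}\setminus\{0\})$ is the space of smooth functions with compact support in $\mathbb{G}\setminus\{0\}$. *)

theory Defs
  imports "HOL-Analysis.Analysis"
begin

subsection \<open>Smooth maps and Lie groups\<close>

text \<open>
  \<open>Ck_on k S f\<close> and \<open>smooth_on S f\<close> are meant only for open sets \<open>S\<close>.
\<close>

primrec Ck_on :: "nat \<Rightarrow> 'a::euclidean_space set \<Rightarrow> ('a \<Rightarrow> 'b::real_normed_vector) \<Rightarrow> bool" where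
  "Ck_on 0 S f \<longleftrightarrow> continuous_on S f"
| "Ck_on (Suc k) S f \<longleftrightarrow>
     (\<forall>x\<in>S. f differentiable (at x)) \<and> (\<forall>v. Ck_on k S (\<lambda>x. frechet_derivative f (at x) v))"

definition smooth_on :: "'a::euclidean_space set \<Rightarrow> ('a \<Rightarrow> 'b::real_normed_vector) \<Rightarrow> bool" where
  "smooth_on S f \<longleftrightarrow> (\<forall>k. Ck_on k S f)"

text \<open>
  A chart is a pair of an open domain and a coordinate map into the model space \<open>'e\<close>.
  The inverse of the coordinate map \<open>\<phi>\<close> with domain \<open>U\<close> is \<open>inv_into U \<phi>\<close>.
\<close>

type_synonym ('g, 'e) chart = "'g set \<times> ('g \<Rightarrow> 'e)"

definition smooth_atlas :: "('g::topological_space, 'e::euclidean_space) chart set \<Rightarrow> bool" where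
  "smooth_atlas \<A> \<longleftrightarrow>
     (\<forall>(U, \<phi>)\<in>\<A>. open U \<and> open (\<phi> ` U) \<and> homeomorphism U (\<phi> ` U) \<phi> (inv_into U \<phi>)) \<and>
     (\<Union>(U, \<phi>)\<in>\<A>. U) = UNIV \<and>
     (\<forall>(U, \<phi>)\<in>\<A>. \<forall>(V, \<psi>)\<in>\<A>. smooth_on (\<phi> ` (U \<inter> V)) (\<psi> \<circ> inv_into U \<phi>))"

definition smooth_fun ::
    "('g::topological_space, 'e::euclidean_space) chart set \<Rightarrow> ('g \<Rightarrow> 'b::real_normed_vector) \<Rightarrow> bool" where
  "smooth_fun \<A> f \<longleftrightarrow> (\<forall>(U, \<phi>)\<in>\<A>. smooth_on (\<phi> ` U) (f \<circ> inv_into U \<phi>))"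

text \<open>
  The group law is written additively, as in the class \<^class>\<open>topological_group_add\<close>, but it is
  not assumed to be commutative; the identity element is \<open>0\<close>.
\<close>

definition lie_group ::
    "('g::{topological_group_add, t2_space, second_countable_topology}, 'e::euclidean_space) chart set
      \<Rightarrow> bool" where
  "lie_group \<A> \<longleftrightarrow> smooth_atlas \<A> \<and>
     (\<forall>(U, \<phi>)\<in>\<A>. \<forall>(V, \<psi>)\<in>\<A>. \<forall>(W, \<xi>)\<in>\<A>.
        smooth_on {(a, b) \<in> \<phi> ` U \<times> \<psi> ` V. inv_into U \<phi> a + inv_into V \<psi> b \<in> W}
          (\<lambda>(a, b). \<xi> (inv_into U \<phi> a + inv_into V \<psi> b))) \<and>
     (\<forall>(U, \<phi>)\<in>\<A>. \<forall>(V, \<psi>)\<in>\<A>.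
        smooth_on {a \<in> \<phi> ` U. - inv_into U \<phi> a \<in> V} (\<lambda>a. \<psi> (- inv_into U \<phi> a)))"

subsection \<open>Lie algebra and exponential map\<close>

text \<open>
  The Lie algebra is the tangent space at the identity, identified with the model space \<open>'e\<close> by a
  chart \<open>c\<close> around \<open>0\<close>: the vector \<open>v\<close> stands for the velocity at \<open>t = 0\<close> of the curve
  \<open>tangent_curve c v\<close>. Its bracket is the commutator of left-invariant vector fields.
\<close>

definition tangent_curve :: "('g::group_add, 'e::euclidean_space) chart \<Rightarrow> 'e \<Rightarrow> real \<Rightarrow> 'g" where
  "tangent_curve c v t = inv_into (fst c) (snd c) (snd c 0 + t *\<^sub>R v)"

definition left_inv_field ::
    "('g::group_add, 'e::euclidean_space) chart \<Rightarrow> 'e \<Rightarrow> ('g \<Rightarrow> real) \<Rightarrow> 'g \<Rightarrow> real" where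
  "left_inv_field c v f x = vector_derivative (\<lambda>t. f (x + tangent_curve c v t)) (at 0)"

definition lie_bracket ::
    "('g::{topological_space, group_add}, 'e::euclidean_space) chart set \<Rightarrow> ('g, 'e) chart \<Rightarrow> 'e \<Rightarrow> 'e \<Rightarrow> 'e"
  where
  "lie_bracket \<A> c v w =
     (THE u. \<forall>f. smooth_fun \<A> f \<longrightarrow> (\<forall>x. left_inv_field c u f x =
        left_inv_field c v (left_inv_field c w f) x - left_inv_field c w (left_inv_field c v f) x))"

definition lie_algebra_morphism ::
    "('g::{topological_space, group_add}, 'e::euclidean_space) chart set \<Rightarrow> ('g, 'e) chart \<Rightarrow> ('e \<Rightarrow> 'e) \<Rightarrow> bool"
  where
  "lie_algebra_morphism \<A> c L \<longleftrightarrow> linear L \<and>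
     (\<forall>v w. L (lie_bracket \<A> c v w) = lie_bracket \<A> c (L v) (L w))"

text \<open>
  The curves \<open>\<lambda>t. Exp (t *\<^sub>R v)\<close> are the one-parameter subgroups with initial velocity \<open>v\<close>;
  this determines \<open>Exp\<close> uniquely.
\<close>

definition exponential_map ::
    "('g::{topological_space, group_add}, 'e::euclidean_space) chart \<Rightarrow> ('e \<Rightarrow> 'g) \<Rightarrow> bool" where
  "exponential_map c Exp \<longleftrightarrow>
     (\<forall>v. (\<forall>s t. Exp ((s + t) *\<^sub>R v) = Exp (s *\<^sub>R v) + Exp (t *\<^sub>R v)) \<and>
          continuous_on UNIV (\<lambda>t::real. Exp (t *\<^sub>R v)) \<and>
          ((\<lambda>t. snd c (Exp (t *\<^sub>R v))) has_vector_derivative v) (at 0))"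

definition global_diffeomorphism ::
    "('g::topological_space, 'e::euclidean_space) chart set \<Rightarrow> ('e \<Rightarrow> 'g) \<Rightarrow> bool" where
  "global_diffeomorphism \<A> h \<longleftrightarrow> bij h \<and> continuous_on UNIV h \<and>
     (\<forall>(U, \<phi>)\<in>\<A>. smooth_on (h -` U) (\<phi> \<circ> h)) \<and> smooth_fun \<A> (inv h)"

subsection \<open>Homogeneous groups\<close>

definition dilation :: "('e::euclidean_space \<Rightarrow> 'e) \<Rightarrow> real \<Rightarrow> 'e \<Rightarrow> 'e" where
  "dilation A r v = (\<Sum>k. (1 / fact k) *\<^sub>R ((\<lambda>w. ln r *\<^sub>R A w) ^^ k) v)"

definition diagonalisable :: "('e::euclidean_space \<Rightarrow> 'e) \<Rightarrow> bool" where
  "diagonalisable A \<longleftrightarrow> linear A \<and>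
     (\<exists>B. independent B \<and> span B = UNIV \<and> (\<forall>b\<in>B. \<exists>\<mu>::real. A b = \<mu> *\<^sub>R b))"

definition linear_trace :: "('e::euclidean_space \<Rightarrow> 'e) \<Rightarrow> real" where
  "linear_trace A = (\<Sum>b\<in>Basis. A b \<bullet> b)"

text \<open>
  That the exponential map of such a group is a global diffeomorphism is a theorem of Lie theory.
  It is recorded as part of the structure because the dilations of the group are only defined
  by way of it.
\<close>

locale homogeneous_group =
  fixes \<A> :: "('g::{topological_group_add, t2_space, second_countable_topology}, 'e::euclidean_space) chart set"
    and c :: "('g, 'e) chart"
    and Exp :: "'e \<Rightarrow> 'g"
    and A :: "'e \<Rightarrow> 'e"
  assumes lie_group: "lie_group \<A>"
    and connected: "connected (UNIV :: 'g set)"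
    and simply_connected: "simply_connected (UNIV :: 'g set)"
    and chart_at_identity: "c \<in> \<A>" "0 \<in> fst c"
    and exponential: "exponential_map c Exp"
    and diffeomorphism: "global_diffeomorphism \<A> Exp"
    and diagonalisable: "diagonalisable A"
    and positive_eigenvalues: "\<And>\<mu> v. v \<noteq> 0 \<Longrightarrow> A v = \<mu> *\<^sub>R v \<Longrightarrow> \<mu> > 0"
    and dilation_morphism: "\<And>r. r > 0 \<Longrightarrow> lie_algebra_morphism \<A> c (dilation A r)"

definition homogeneous_dimension :: "('e::euclidean_space \<Rightarrow> 'e) \<Rightarrow> real" where
  "homogeneous_dimension A = linear_trace A"

definition group_dilation :: "('e::euclidean_space \<Rightarrow> 'g) \<Rightarrow> ('e \<Rightarrow> 'e) \<Rightarrow> real \<Rightarrow> 'g \<Rightarrow> 'g" where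
  "group_dilation Exp A r x = Exp (dilation A r (inv Exp x))"

definition haar_measure :: "'g::{topological_space, group_add} measure \<Rightarrow> bool" where
  "haar_measure M \<longleftrightarrow> sets M = sets borel \<and>
     (\<forall>a. distr M borel (\<lambda>x. a + x) = M) \<and>
     (\<forall>K. compact K \<longrightarrow> emeasure M K < \<infinity>) \<and>
     (\<forall>U. open U \<and> U \<noteq> {} \<longrightarrow> emeasure M U > 0)"

definition homogeneous_quasi_norm ::
    "('e::euclidean_space \<Rightarrow> 'g::{topological_space, group_add}) \<Rightarrow> ('e \<Rightarrow> 'e) \<Rightarrow> ('g \<Rightarrow> real) \<Rightarrow> bool" where
  "homogeneous_quasi_norm Exp A N \<longleftrightarrow> continuous_on UNIV N \<and> (\<forall>x. N x \<ge> 0) \<and>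
     (\<forall>x. N (- x) = N x) \<and>
     (\<forall>x r. r > 0 \<longrightarrow> N (group_dilation Exp A r x) = r * N x) \<and>
     (\<forall>x. N x = 0 \<longleftrightarrow> x = 0)"

text \<open>
  For \<open>x \<noteq> 0\<close> the point \<open>y\<close> below is the unique one with \<open>N y = 1\<close> and
  \<open>x = group_dilation Exp A (N x) y\<close>. The value at \<open>x = 0\<close> is irrelevant.
\<close>

definition radial_derivative ::
    "('e::euclidean_space \<Rightarrow> 'g) \<Rightarrow> ('e \<Rightarrow> 'e) \<Rightarrow> ('g \<Rightarrow> real) \<Rightarrow> ('g \<Rightarrow> complex) \<Rightarrow> 'g \<Rightarrow> complex" where
  "radial_derivative Exp A N f x =
     (let y = group_dilation Exp A (1 / N x) x
      in vector_derivative (\<lambda>r. f (group_dilation Exp A r y)) (at (N x)))"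

definition test_functions_off_zero ::
    "('g::{topological_space, group_add}, 'e::euclidean_space) chart set \<Rightarrow> ('g \<Rightarrow> complex) set" where
  "test_functions_off_zero \<A> =
     {f. smooth_fun \<A> f \<and> compact (closure {x. f x \<noteq> 0}) \<and> 0 \<notin> closure {x. f x \<noteq> 0}}"

end

theory Submission
  imports Defs
begin

text \<open>
  In exponential coordinates the derivative \<open>T x\<close> of the left translation by \<open>x\<close> at the identity
  satisfies, along rays, a linear differential equation built from the Lie bracket. Hence every
  automorphism \<open>L\<close> of the Lie algebra conjugates \<open>T x\<close> into \<open>T (L x)\<close>, so the density
  \<open>1 / \<bar>det (T x)\<bar>\<close> of Haar measure is invariant under dilations, and Haar measure scales by
  \<open>r\<^sup>Q\<close>. Neither the Baker-Campbell-Hausdorff formula nor nilpotency is needed.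

  Differentiating the scaling identity for \<open>(\<bar>f\<bar> / \<bar>x\<bar>)\<^sup>p\<close> at \<open>r = 1\<close> gives Hardy's inequality
  \<open>(Q - p) / p * \<parallel>f / \<bar>x\<bar>\<parallel>\<^sub>p \<le> \<parallel>\<R> f\<parallel>\<^sub>p\<close>, and Hoelder's inequality applied to
  \<open>\<bar>f\<bar>\<^sup>2 = (\<bar>f\<bar> / \<bar>x\<bar>) (\<bar>x\<bar> \<bar>f\<bar>)\<close> finishes the proof.
\<close>

text \<open>The dilations are given only as morphisms of the Lie algebra, whereas the scaling law
  concerns a measure tied to the group law. The bridge is that in exponential coordinates the
  left-invariant density depends on the bracket alone. The equation along a ray is singular at the
  identity; multiplying the inverse of \<open>T\<close> by the ray parameter makes it regular and
  gives it the initial value 0, so a linear map that respects brackets carries solutions to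
  solutions and uniqueness does the rest. Two identifications make this applicable. The bracket of
  the structure is a definite description over smooth functions on the group and has to be
  recognised as the coordinate bracket. The measure \<open>M\<close> is an arbitrary left Haar
  measure, so the law computed for the explicit density reaches \<open>M\<close> through uniqueness
  up to a factor; this factor cancels because both sides of the law are linear in the
  measure.\<close>

subsection \<open>Calculus of smooth maps\<close>

text \<open>On an open \<open>S\<close> the derivative at a point of \<open>S\<close> only sees
  values taken on \<open>S\<close>, so the derivatives of \<open>f\<close> and \<open>g\<close>
  agree there and the induction can continue with them.\<close>

lemma Ck_on_cong:
  assumes "open S" "\<And>x. x \<in> S \<Longrightarrow> f x = g x" "Ck_on k S f"
  shows "Ck_on k S g"
  using assms(2,3)
proof (induction k arbitrary: f g)
  case 0
  then show ?case by (auto cong: continuous_on_cong)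
next
  case (Suc k)
  have d: "(g has_derivative frechet_derivative f (at x)) (at x)" if "x \<in> S" for x
    using Suc.prems that assms(1) frechet_derivative_works[of f "at x"]
      has_derivative_transform_within_open[of f _ x UNIV S g] by auto
  then have "frechet_derivative f (at x) = frechet_derivative g (at x)" if "x \<in> S" for x
    using that frechet_derivative_at by blast
  then have "Ck_on k S (\<lambda>x. frechet_derivative g (at x) v)" for v
    using Suc.prems(2) by (rule_tac Suc.IH[of "\<lambda>x. frechet_derivative f (at x) v"]) auto
  with d show ?case by (auto simp: differentiable_def)
qed

text \<open>\<open>frechet_derivative\<close> is given by choice. On an open set any explicit
  formula for the derivative may replace it, which is how sums, products and compositions are
  treated.\<close>

lemma Ck_on_SucI:
  assumes "open S" "\<And>x. x \<in> S \<Longrightarrow> (f has_derivative f' x) (at x)"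
    and "\<And>v. Ck_on k S (\<lambda>x. f' x v)"
  shows "Ck_on (Suc k) S f"
proof -
  have "f' x = frechet_derivative f (at x)" if "x \<in> S" for x
    using assms(2) that frechet_derivative_at by blast
  then have "Ck_on k S (\<lambda>x. frechet_derivative f (at x) v)" for v
    using assms(3) by (rule_tac Ck_on_cong[OF assms(1), of "\<lambda>x. f' x v"]) auto
  then show ?thesis using assms(2) by (auto simp: differentiable_def)
qed

lemma Ck_on_SucD_has_derivative:
  assumes "Ck_on (Suc k) S f" "x \<in> S"
  shows "(f has_derivative frechet_derivative f (at x)) (at x)"
  using assms by (intro frechet_derivative_works[THEN iffD1]) simp

lemma Ck_on_subset: "Ck_on k S f \<Longrightarrow> T \<subseteq> S \<Longrightarrow> Ck_on k T f"
proof (induction k arbitrary: f)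
  case 0
  then show ?case by (auto intro: continuous_on_subset)
next
  case (Suc k)
  show ?case unfolding Ck_on.simps
  proof (intro conjI ballI allI)
    show "f differentiable at x" if "x \<in> T" for x using Suc.prems that by auto
    show "Ck_on k T (\<lambda>x. frechet_derivative f (at x) v)" for v
      by (rule Suc.IH[OF _ Suc.prems(2)]) (use Suc.prems(1) in simp)
  qed
qed

text \<open>Meant for gluing: on the group, smoothness is known chart by chart only.\<close>

lemma Ck_on_local:
  assumes "\<And>x. x \<in> S \<Longrightarrow> \<exists>U. open U \<and> x \<in> U \<and> Ck_on k U f"
  shows "Ck_on k S f"
  using assms
proof (induction k arbitrary: f)
  case 0
  then show ?case
    using continuous_at_imp_continuous_on continuous_on_eq_continuous_at by (metis Ck_on.simps(1))
next
  case (Suc k)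
  have "Ck_on k S (\<lambda>x. frechet_derivative f (at x) v)" for v
  proof (rule Suc.IH)
    fix x assume "x \<in> S"
    from Suc.prems[OF this] obtain U where "open U" "x \<in> U" "Ck_on (Suc k) U f" by blast
    then show "\<exists>U. open U \<and> x \<in> U \<and> Ck_on k U (\<lambda>x. frechet_derivative f (at x) v)" by auto
  qed
  moreover have "f differentiable at x" if x: "x \<in> S" for x
  proof -
    from Suc.prems[OF x] obtain U where "x \<in> U" "Ck_on (Suc k) U f" by blast
    then show ?thesis by simp
  qed
  ultimately show ?case by simp
qed

lemma Ck_on_SucD: "Ck_on (Suc k) S f \<Longrightarrow> Ck_on k S f"
proof (induction k arbitrary: f)
  case 0
  then show ?case
    by (auto intro!: continuous_at_imp_continuous_on differentiable_imp_continuous_within)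
next
  case (Suc k)
  show ?case unfolding Ck_on.simps(2)[of k]
  proof (intro conjI ballI allI)
    show "f differentiable at x" if "x \<in> S" for x using Suc.prems that by auto
    show "Ck_on k S (\<lambda>x. frechet_derivative f (at x) v)" for v
      by (rule Suc.IH) (use Suc.prems in auto)
  qed
qed

lemma Ck_on_const: "Ck_on k S (\<lambda>x. c)"
proof (induction k arbitrary: c)
  case 0 then show ?case by simp
next
  case (Suc k)
  have "frechet_derivative (\<lambda>_. c) (at x) v = 0" for x v :: 'a
    by (metis frechet_derivative_const)
  with Suc show ?case by (simp del: frechet_derivative_const)
qed

lemma Ck_on_bounded_linear:
  assumes "bounded_linear L"
  shows "Ck_on k S L"
proof (cases k)
  case 0 with assms show ?thesis by (simp add: linear_continuous_on)
next
  case (Suc j)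
  have "Ck_on (Suc j) UNIV L"
    using assms by (intro Ck_on_SucI[of _ _ "\<lambda>_. L"] Ck_on_const) (auto simp: bounded_linear_imp_has_derivative)
  then show ?thesis using Suc Ck_on_subset by blast
qed

lemma Ck_on_linear_compose:
  assumes "open S" "bounded_linear L" "Ck_on k S f"
  shows "Ck_on k S (\<lambda>x. L (f x))"
  using assms(3)
proof (induction k arbitrary: f)
  case 0
  then show ?case using assms(2) by (auto intro: bounded_linear.continuous_on)
next
  case (Suc k)
  show ?case
  proof (rule Ck_on_SucI[OF assms(1)])
    show "((\<lambda>x. L (f x)) has_derivative (\<lambda>v. L (frechet_derivative f (at x) v))) (at x)" if "x \<in> S" for x
      using bounded_linear.has_derivative[OF assms(2) Ck_on_SucD_has_derivative[OF Suc.prems that]] .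
    show "Ck_on k S (\<lambda>x. L (frechet_derivative f (at x) v))" for v
      using Suc by auto
  qed
qed

lemma Ck_on_add:
  assumes "open S" "Ck_on k S f" "Ck_on k S g"
  shows "Ck_on k S (\<lambda>x. f x + g x)"
  using assms(2,3)
proof (induction k arbitrary: f g)
  case 0
  then show ?case by (auto intro: continuous_intros)
next
  case (Suc k)
  show ?case
  proof (rule Ck_on_SucI[OF assms(1)])
    show "((\<lambda>x. f x + g x) has_derivative
        (\<lambda>v. frechet_derivative f (at x) v + frechet_derivative g (at x) v)) (at x)" if "x \<in> S" for x
      using has_derivative_add[OF Suc.prems[THEN Ck_on_SucD_has_derivative[OF _ that]]] .
    show "Ck_on k S (\<lambda>x. frechet_derivative f (at x) v + frechet_derivative g (at x) v)" for v
      using Suc by auto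
  qed
qed

lemma Ck_on_sum:
  assumes "open S" "\<And>i. i \<in> I \<Longrightarrow> Ck_on k S (f i)"
  shows "Ck_on k S (\<lambda>x. \<Sum>i\<in>I. f i x)"
  using assms(2)
  by (induction I rule: infinite_finite_induct) (auto intro: Ck_on_const Ck_on_add[OF assms(1)])

lemma Ck_on_scaleR:
  fixes f :: "'a::euclidean_space \<Rightarrow> real"
  assumes "open S" "Ck_on k S f" "Ck_on k S g"
  shows "Ck_on k S (\<lambda>x. f x *\<^sub>R g x)"
  using assms(2,3)
proof (induction k arbitrary: f g)
  case 0
  then show ?case by (auto intro: continuous_intros)
next
  case (Suc k)
  show ?case
  proof (rule Ck_on_SucI[OF assms(1)])
    show "((\<lambda>x. f x *\<^sub>R g x) has_derivative
        (\<lambda>v. f x *\<^sub>R frechet_derivative g (at x) v + frechet_derivative f (at x) v *\<^sub>R g x)) (at x)"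
      if "x \<in> S" for x
      using has_derivative_scaleR[OF Suc.prems[THEN Ck_on_SucD_has_derivative[OF _ that]]] .
    show "Ck_on k S (\<lambda>x. f x *\<^sub>R frechet_derivative g (at x) v + frechet_derivative f (at x) v *\<^sub>R g x)" for v
      using Suc.prems Ck_on_SucD[OF Suc.prems(1)] Ck_on_SucD[OF Suc.prems(2)]
      by (intro Ck_on_add[OF assms(1)] Suc.IH) auto
  qed
qed

lemma linear_expand_Basis:
  fixes L :: "'a::euclidean_space \<Rightarrow> 'b::real_vector"
  assumes "linear L"
  shows "L v = (\<Sum>b\<in>Basis. (v \<bullet> b) *\<^sub>R L b)"
proof -
  have "L v = L (\<Sum>b\<in>Basis. (v \<bullet> b) *\<^sub>R b)" by (simp add: euclidean_representation)
  then show ?thesis by (simp add: linear_sum[OF assms] linear_scale[OF assms])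
qed

text \<open>The chain rule evaluates the derivative of \<open>f\<close> in a direction that varies
  with \<open>x\<close>, which the recursive definition does not cover. Expanding this direction
  over \<open>Basis\<close> leaves products of scalar functions with derivatives of \<open>f\<close>
  in fixed directions composed with \<open>g\<close>, and to these the induction hypothesis
  applies.\<close>

lemma Ck_on_compose:
  fixes f :: "'b::euclidean_space \<Rightarrow> 'c::real_normed_vector" and g :: "'a::euclidean_space \<Rightarrow> 'b"
  assumes S: "open S" and "Ck_on k T f" "Ck_on k S g" "g ` S \<subseteq> T"
  shows "Ck_on k S (\<lambda>x. f (g x))"
  using assms(2,3)
proof (induction k arbitrary: f)
  case 0
  then show ?case using assms(4) by (auto intro: continuous_on_compose2)
next
  case (Suc k)
  let ?f' = "\<lambda>y. frechet_derivative f (at y)" and ?g' = "\<lambda>x. frechet_derivative g (at x)"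
  show ?case
  proof (rule Ck_on_SucI[OF S])
    fix x assume x: "x \<in> S"
    then have y: "g x \<in> T" using assms(4) by auto
    have f: "(f has_derivative ?f' (g x)) (at (g x))"
      using Ck_on_SucD_has_derivative[OF Suc.prems(1) y] .
    have lin: "linear (?f' (g x))" using f has_derivative_linear by blast
    have "((\<lambda>x. f (g x)) has_derivative (\<lambda>v. ?f' (g x) (?g' x v))) (at x)"
      using has_derivative_compose[OF Ck_on_SucD_has_derivative[OF Suc.prems(2) x] f] .
    then show "((\<lambda>x. f (g x)) has_derivative (\<lambda>v. \<Sum>b\<in>Basis. (?g' x v \<bullet> b) *\<^sub>R ?f' (g x) b)) (at x)"
      by (simp only: linear_expand_Basis[OF lin, symmetric])
  next
    fix v
    show "Ck_on k S (\<lambda>x. \<Sum>b\<in>Basis. (?g' x v \<bullet> b) *\<^sub>R ?f' (g x) b)"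
    proof (intro Ck_on_sum[OF S] Ck_on_scaleR[OF S])
      fix b :: 'b
      show "Ck_on k S (\<lambda>x. ?g' x v \<bullet> b)"
        using Suc.prems(2) by (rule_tac Ck_on_linear_compose[OF S bounded_linear_inner_left]) auto
      show "Ck_on k S (\<lambda>x. ?f' (g x) b)"
        using Suc.prems Ck_on_SucD[OF Suc.prems(2)] by (rule_tac Suc.IH) auto
    qed
  qed
qed

lemma smooth_on_cong:
  "open S \<Longrightarrow> (\<And>x. x \<in> S \<Longrightarrow> f x = g x) \<Longrightarrow> smooth_on S f \<Longrightarrow> smooth_on S g"
  unfolding smooth_on_def using Ck_on_cong by blast

lemma smooth_on_local:
  assumes "\<And>x. x \<in> S \<Longrightarrow> \<exists>U. open U \<and> x \<in> U \<and> smooth_on U f"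
  shows "smooth_on S f"
  using assms unfolding smooth_on_def by (meson Ck_on_local)

lemma smooth_on_bounded_linear: "bounded_linear L \<Longrightarrow> smooth_on S L"
  unfolding smooth_on_def using Ck_on_bounded_linear by blast

lemma smooth_on_const: "smooth_on S (\<lambda>x. c)"
  unfolding smooth_on_def using Ck_on_const by blast

lemma smooth_on_compose:
  fixes f :: "'b::euclidean_space \<Rightarrow> 'c::real_normed_vector" and g :: "'a::euclidean_space \<Rightarrow> 'b"
  assumes "smooth_on T f" "smooth_on S g" "open S" "g ` S \<subseteq> T"
  shows "smooth_on S (\<lambda>x. f (g x))"
  using assms Ck_on_compose[of S _ T f g] unfolding smooth_on_def by blast

lemma smooth_on_add: "open S \<Longrightarrow> smooth_on S f \<Longrightarrow> smooth_on S g \<Longrightarrow> smooth_on S (\<lambda>x. f x + g x)"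
  unfolding smooth_on_def using Ck_on_add[of S _ f g] by blast

lemma smooth_on_sum:
  "open S \<Longrightarrow> (\<And>i. i \<in> I \<Longrightarrow> smooth_on S (f i)) \<Longrightarrow> smooth_on S (\<lambda>x. \<Sum>i\<in>I. f i x)"
  unfolding smooth_on_def using Ck_on_sum[of S I _ f] by blast

lemma smooth_on_scaleR:
  fixes f :: "'a::euclidean_space \<Rightarrow> real"
  shows "open S \<Longrightarrow> smooth_on S f \<Longrightarrow> smooth_on S g \<Longrightarrow> smooth_on S (\<lambda>x. f x *\<^sub>R g x)"
  unfolding smooth_on_def using Ck_on_scaleR[of S _ f g] by blast

lemma smooth_on_linear_compose:
  "open S \<Longrightarrow> bounded_linear L \<Longrightarrow> smooth_on S f \<Longrightarrow> smooth_on S (\<lambda>x. L (f x))"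
  unfolding smooth_on_def using Ck_on_linear_compose[of S L _ f] by blast

lemma smooth_on_Pair:
  fixes f :: "'a::euclidean_space \<Rightarrow> 'b::euclidean_space" and g :: "'a \<Rightarrow> 'c::euclidean_space"
  assumes "open S" "smooth_on S f" "smooth_on S g"
  shows "smooth_on S (\<lambda>x. (f x, g x))"
proof -
  have "smooth_on S (\<lambda>x. (f x, 0) + (0, g x))"
    using assms
    by (intro smooth_on_add smooth_on_linear_compose[of S "\<lambda>y. (y, 0)"] smooth_on_linear_compose[of S "\<lambda>y. (0, y)"])
       (auto intro!: bounded_linear_Pair bounded_linear_ident bounded_linear_zero)
  then show ?thesis by simp
qed

lemma smooth_on_has_derivative:
  "smooth_on S f \<Longrightarrow> x \<in> S \<Longrightarrow> (f has_derivative frechet_derivative f (at x)) (at x)"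
  using Ck_on_SucD_has_derivative unfolding smooth_on_def by blast

lemma smooth_on_continuous_on: "smooth_on S f \<Longrightarrow> continuous_on S f"
  unfolding smooth_on_def by (metis Ck_on.simps(1))

lemma frechet_derivative_eqI:
  "(f has_derivative f') (at x) \<Longrightarrow> frechet_derivative f (at x) v = f' v"
  using frechet_derivative_at by metis

lemma smooth_on_frechet_derivative:
  "smooth_on S f \<Longrightarrow> smooth_on S (\<lambda>x. frechet_derivative f (at x) v)"
  unfolding smooth_on_def by (metis Ck_on.simps(2))

text \<open>In a fixed direction the derivative is smooth by definition. Linearity in the direction
  upgrades this to joint smoothness, through a finite sum of coordinates of \<open>v\<close> times
  derivatives along basis vectors.\<close>

lemma smooth_on_frechet_derivative_joint:
  fixes f :: "'a::euclidean_space \<Rightarrow> 'b::real_normed_vector"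
  assumes "smooth_on UNIV f"
  shows "smooth_on UNIV (\<lambda>(x, v). frechet_derivative f (at x) v)"
proof -
  have lin: "linear (frechet_derivative f (at x))" for x
    using has_derivative_linear smooth_on_has_derivative[OF assms] by blast
  have "smooth_on UNIV (\<lambda>z::'a \<times> 'a. \<Sum>b\<in>Basis. (snd z \<bullet> b) *\<^sub>R frechet_derivative f (at (fst z)) b)"
  proof (intro smooth_on_sum smooth_on_scaleR open_UNIV)
    fix b :: 'a
    show "smooth_on UNIV (\<lambda>z::'a \<times> 'a. snd z \<bullet> b)"
      by (intro smooth_on_bounded_linear bounded_linear_inner_left_comp bounded_linear_snd)
    show "smooth_on UNIV (\<lambda>z::'a \<times> 'a. frechet_derivative f (at (fst z)) b)"
      by (rule smooth_on_compose[OF smooth_on_frechet_derivative[OF assms]])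
         (auto intro: smooth_on_bounded_linear bounded_linear_fst)
  qed
  then show ?thesis
    by (simp add: case_prod_unfold linear_expand_Basis[OF lin, symmetric])
qed

lemma smooth_on_has_vector_derivative_line:
  assumes "smooth_on UNIV F"
  shows "((\<lambda>s. F (z + s *\<^sub>R v)) has_vector_derivative frechet_derivative F (at (z + s *\<^sub>R v)) v) (at s)"
proof -
  have F: "(F has_derivative frechet_derivative F (at (z + s *\<^sub>R v))) (at (z + s *\<^sub>R v))"
    using smooth_on_has_derivative[OF assms] by simp
  have "((\<lambda>s. F (z + s *\<^sub>R v)) has_derivative (\<lambda>k. frechet_derivative F (at (z + s *\<^sub>R v)) (k *\<^sub>R v))) (at s)"
    by (rule has_derivative_compose[where f = "\<lambda>s. z + s *\<^sub>R v" and g = F, OF _ F]) (auto intro!: derivative_eq_intros)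
  then show ?thesis
    by (simp add: has_vector_derivative_def linear_scale[OF has_derivative_linear[OF F]])
qed

text \<open>
  Both mixed derivatives are limits of the same second difference, by applying the mean value
  theorem once in each direction.
\<close>

lemma second_difference_mean_value:
  fixes F :: "'a::euclidean_space \<Rightarrow> real"
  assumes F: "smooth_on UNIV F" and h: "h > 0"
  obtains s t where "0 < s" "s < h" "0 < t" "t < h"
    "F (x + h *\<^sub>R v + h *\<^sub>R w) - F (x + h *\<^sub>R v) - F (x + h *\<^sub>R w) + F x
      = h * (h * frechet_derivative (\<lambda>y. frechet_derivative F (at y) v) (at (x + s *\<^sub>R v + t *\<^sub>R w)) w)"
proof -
  let ?F' = "\<lambda>y. frechet_derivative F (at y)"
  have F': "smooth_on UNIV (\<lambda>y. ?F' y v)" using smooth_on_frechet_derivative[OF F] .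
  have "((\<lambda>s. F (x + s *\<^sub>R v + h *\<^sub>R w) - F (x + s *\<^sub>R v)) has_real_derivative
      ?F' (x + s *\<^sub>R v + h *\<^sub>R w) v - ?F' (x + s *\<^sub>R v) v) (at s)" for s
  proof -
    have *: "((\<lambda>s. F (z + s *\<^sub>R v)) has_real_derivative ?F' (z + s *\<^sub>R v) v) (at s)" for z
      using smooth_on_has_vector_derivative_line[OF F]
      by (simp add: has_real_derivative_iff_has_vector_derivative)
    have "((\<lambda>s. F ((x + h *\<^sub>R w) + s *\<^sub>R v) - F (x + s *\<^sub>R v)) has_real_derivative
      ?F' ((x + h *\<^sub>R w) + s *\<^sub>R v) v - ?F' (x + s *\<^sub>R v) v) (at s)"
      by (intro DERIV_diff *)
    then show ?thesis by (simp add: algebra_simps)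
  qed
  from MVT2[OF h this] obtain s where s: "0 < s" "s < h"
    and 1: "F (x + h *\<^sub>R v + h *\<^sub>R w) - F (x + h *\<^sub>R v) - (F (x + h *\<^sub>R w) - F x)
      = h * (?F' (x + s *\<^sub>R v + h *\<^sub>R w) v - ?F' (x + s *\<^sub>R v) v)" by auto
  have "((\<lambda>t. ?F' (x + s *\<^sub>R v + t *\<^sub>R w) v) has_real_derivative
      frechet_derivative (\<lambda>y. ?F' y v) (at (x + s *\<^sub>R v + t *\<^sub>R w)) w) (at t)" for t
    using smooth_on_has_vector_derivative_line[OF F']
    by (simp add: has_real_derivative_iff_has_vector_derivative)
  from MVT2[OF h this] obtain t where "0 < t" "t < h" and 2: "?F' (x + s *\<^sub>R v + h *\<^sub>R w) v - ?F' (x + s *\<^sub>R v) v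
      = h * frechet_derivative (\<lambda>y. ?F' y v) (at (x + s *\<^sub>R v + t *\<^sub>R w)) w" by auto
  with s 1 show ?thesis by (intro that[of s t]) auto
qed

lemma second_derivative_symmetric:
  fixes F :: "'a::euclidean_space \<Rightarrow> real"
  assumes F: "smooth_on UNIV F"
  shows "frechet_derivative (\<lambda>y. frechet_derivative F (at y) v) (at x) w
       = frechet_derivative (\<lambda>y. frechet_derivative F (at y) w) (at x) v"
proof -
  define P where "P v w y = frechet_derivative (\<lambda>y. frechet_derivative F (at y) v) (at y) w" for v w y
  have cont: "isCont (P v w) x" for v w
    unfolding P_def using smooth_on_continuous_on[OF smooth_on_frechet_derivative[OF smooth_on_frechet_derivative[OF F]]]
    by (simp add: continuous_on_eq_continuous_at)
  have "\<bar>P v w x - P w v x\<bar> \<le> e" if e: "e > 0" for e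
  proof -
    obtain d1 d2 where d: "d1 > 0" "d2 > 0"
      "\<And>y. dist y x < d1 \<Longrightarrow> dist (P v w y) (P v w x) < e/2"
      "\<And>y. dist y x < d2 \<Longrightarrow> dist (P w v y) (P w v x) < e/2"
      using cont[of v w] cont[of w v] e unfolding continuous_at_eps_delta by (metis half_gt_zero)
    \<comment> \<open>The parallelogram spanned by \<open>h *\<^sub>R v\<close> and
      \<open>h *\<^sub>R w\<close> lies within \<open>h * (norm v + norm w)\<close> of
      \<open>x\<close>. The extra 1 keeps \<open>C\<close> positive and makes the bound by
      \<open>min d1 d2\<close> strict.\<close>
    define C where "C = norm v + norm w + 1"
    have C: "C > 0" unfolding C_def by (simp add: add_nonneg_pos)
    define h where "h = min d1 d2 / C"
    have h: "h > 0" using d C by (simp add: h_def)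
    have near: "dist (x + s *\<^sub>R v' + t *\<^sub>R w') x < min d1 d2"
      if "0 < s" "s < h" "0 < t" "t < h" "norm v' + norm w' = norm v + norm w" for s t v' w'
    proof -
      have "dist (x + s *\<^sub>R v' + t *\<^sub>R w') x \<le> s * norm v' + t * norm w'"
        using that norm_triangle_ineq[of "s *\<^sub>R v'" "t *\<^sub>R w'"] by (simp add: dist_norm add.assoc)
      also have "\<dots> \<le> h * norm v' + h * norm w'"
        using that by (intro add_mono mult_right_mono) auto
      also have "\<dots> < h * C" using h that by (simp add: C_def distrib_left[symmetric])
      also have "\<dots> = min d1 d2" using C by (simp add: h_def)
      finally show ?thesis .
    qed
    obtain s t where st: "0 < s" "s < h" "0 < t" "t < h"
      "F (x + h *\<^sub>R v + h *\<^sub>R w) - F (x + h *\<^sub>R v) - F (x + h *\<^sub>R w) + F x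
      = h * (h * P v w (x + s *\<^sub>R v + t *\<^sub>R w))"
      using second_difference_mean_value[OF F h, of x v w] unfolding P_def by metis
    obtain s' t' where st': "0 < s'" "s' < h" "0 < t'" "t' < h"
      "F (x + h *\<^sub>R w + h *\<^sub>R v) - F (x + h *\<^sub>R w) - F (x + h *\<^sub>R v) + F x
      = h * (h * P w v (x + s' *\<^sub>R w + t' *\<^sub>R v))"
      using second_difference_mean_value[OF F h, of x w v] unfolding P_def by metis
    have "h * (h * P v w (x + s *\<^sub>R v + t *\<^sub>R w)) = h * (h * P w v (x + s' *\<^sub>R w + t' *\<^sub>R v))"
      unfolding st(5)[symmetric] st'(5)[symmetric] by (simp add: algebra_simps)
    then have "P v w (x + s *\<^sub>R v + t *\<^sub>R w) = P w v (x + s' *\<^sub>R w + t' *\<^sub>R v)"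
      using h by simp
    moreover have "dist (P v w (x + s *\<^sub>R v + t *\<^sub>R w)) (P v w x) < e/2"
      using near[of s t v w] st d by auto
    moreover have "dist (P w v (x + s' *\<^sub>R w + t' *\<^sub>R v)) (P w v x) < e/2"
      using near[of s' t' w v] st' d by auto
    ultimately show ?thesis unfolding dist_real_def by arith
  qed
  then have "\<bar>P v w x - P w v x\<bar> \<le> 0" by (rule field_le_epsilon) simp
  then show ?thesis by (simp add: P_def)
qed

subsection \<open>Left-invariant fields in exponential coordinates\<close>

text \<open>A group law read in exponential coordinates. \<open>mult_line\<close> says that rays
  through 0 are one-parameter subgroups, so negation is the inverse. The bracket is no extra datum;
  it is derived from \<open>mult\<close>.\<close>

locale exponential_coordinates =
  fixes mult :: "'e::euclidean_space \<Rightarrow> 'e \<Rightarrow> 'e"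
  assumes smooth_mult: "smooth_on UNIV (\<lambda>(a, b). mult a b)"
    and mult_assoc: "mult (mult a b) c = mult a (mult b c)"
    and mult_0_left: "mult 0 a = a"
    and mult_0_right: "mult a 0 = a"
    and mult_line: "mult (s *\<^sub>R v) (t *\<^sub>R v) = (s + t) *\<^sub>R v"
begin

lemma mult_minus_left: "mult (- a) a = 0"
  using mult_line[of "-1" a 1] by simp

lemma mult_minus_right: "mult a (- a) = 0"
  using mult_line[of 1 a "-1"] by simp

lemma smooth_translation: "smooth_on UNIV (mult a)"
  using smooth_on_compose[OF smooth_mult smooth_on_Pair[OF open_UNIV smooth_on_const[of UNIV a]
        smooth_on_bounded_linear[OF bounded_linear_ident]]] by simp

text \<open>
  The field \<open>\<lambda>x. frame x v\<close> is the left-invariant field with value \<open>v\<close> at the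
  identity, and \<open>coframe x\<close> is the inverse of \<open>frame x\<close>.
\<close>

definition frame :: "'e \<Rightarrow> 'e \<Rightarrow> 'e" where
  "frame x v = frechet_derivative (mult x) (at 0) v"

definition coframe :: "'e \<Rightarrow> 'e \<Rightarrow> 'e" where
  "coframe x v = frechet_derivative (mult (- x)) (at x) v"

definition field :: "'e \<Rightarrow> ('e \<Rightarrow> real) \<Rightarrow> 'e \<Rightarrow> real" where
  "field v F x = frechet_derivative F (at x) (frame x v)"

text \<open>The coordinate form of the commutator \<open>[V, W]\<close> of the left-invariant fields
  \<open>V\<close> and \<open>W\<close> of \<open>v\<close> and \<open>w\<close>, with the sign for
  which it acts on functions as \<open>V W - W V\<close>.\<close>

definition commutator :: "'e \<Rightarrow> 'e \<Rightarrow> 'e \<Rightarrow> 'e" where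
  "commutator v w x = frechet_derivative (\<lambda>y. frame y w) (at x) (frame x v)
     - frechet_derivative (\<lambda>y. frame y v) (at x) (frame x w)"

definition bracket :: "'e \<Rightarrow> 'e \<Rightarrow> 'e" where
  "bracket v w = commutator v w 0"

lemma translation_has_derivative:
  "(mult a has_derivative frechet_derivative (mult a) (at x)) (at x)"
  using smooth_on_has_derivative[OF smooth_translation] by simp

lemma frame_has_derivative: "(mult x has_derivative frame x) (at 0)"
  using translation_has_derivative unfolding frame_def[abs_def] .

lemma coframe_has_derivative: "(mult (- x) has_derivative coframe x) (at x)"
  using translation_has_derivative unfolding coframe_def[abs_def] .

lemma linear_frame: "linear (frame x)"
  using frame_has_derivative has_derivative_linear by blast

lemma linear_coframe: "linear (coframe x)"
  using coframe_has_derivative has_derivative_linear by blast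

text \<open>As a partial derivative of the product, the derivative of a translation is smooth in the
  translating element too, not only in base point and direction.\<close>

lemma translation_derivative_joint:
  "frechet_derivative (mult a) (at x) v = frechet_derivative (\<lambda>(a, b). mult a b) (at (a, x)) (0, v)"
proof -
  let ?m = "\<lambda>(a, b). mult a b"
  have "((\<lambda>y. ?m (a, y)) has_derivative (\<lambda>v. frechet_derivative ?m (at (a, x)) (0, v))) (at x)"
    by (rule has_derivative_compose[where f = "\<lambda>y. (a, y)" and g = ?m,
          OF _ smooth_on_has_derivative[OF smooth_mult UNIV_I]])
       (auto intro!: derivative_eq_intros)
  then have "(mult a has_derivative (\<lambda>v. frechet_derivative ?m (at (a, x)) (0, v))) (at x)" by simp
  then show ?thesis by (rule frechet_derivative_eqI)
qed

lemma smooth_translation_derivative: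
  fixes \<alpha> \<beta> \<gamma> :: "'c::euclidean_space \<Rightarrow> 'e"
  assumes "smooth_on UNIV \<alpha>" "smooth_on UNIV \<beta>" "smooth_on UNIV \<gamma>"
  shows "smooth_on UNIV (\<lambda>z. frechet_derivative (mult (\<alpha> z)) (at (\<beta> z)) (\<gamma> z))"
proof -
  have "smooth_on UNIV (\<lambda>z. ((\<alpha> z, \<beta> z), (0::'e, \<gamma> z)))"
    by (intro smooth_on_Pair assms smooth_on_const open_UNIV)
  from smooth_on_compose[OF smooth_on_frechet_derivative_joint[OF smooth_mult] this open_UNIV]
  show ?thesis by (simp add: translation_derivative_joint)
qed

lemma smooth_frame:
  fixes \<alpha> \<gamma> :: "'c::euclidean_space \<Rightarrow> 'e"
  assumes "smooth_on UNIV \<alpha>" "smooth_on UNIV \<gamma>"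
  shows "smooth_on UNIV (\<lambda>z. frame (\<alpha> z) (\<gamma> z))"
  unfolding frame_def by (intro smooth_translation_derivative assms smooth_on_const)

lemma smooth_coframe:
  fixes \<alpha> \<gamma> :: "'c::euclidean_space \<Rightarrow> 'e"
  assumes "smooth_on UNIV \<alpha>" "smooth_on UNIV \<gamma>"
  shows "smooth_on UNIV (\<lambda>z. coframe (\<alpha> z) (\<gamma> z))"
proof -
  have "smooth_on UNIV (\<lambda>z. - \<alpha> z)"
    by (rule smooth_on_linear_compose[OF open_UNIV _ assms(1)]) (simp add: bounded_linear_minus bounded_linear_ident)
  then show ?thesis
    unfolding coframe_def by (intro smooth_translation_derivative assms)
qed

lemma smooth_ident: "smooth_on S (\<lambda>x::'c::euclidean_space. x)"
  by (intro smooth_on_bounded_linear bounded_linear_ident)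

text \<open>Differentiate associativity, \<open>mult a (mult x y) = mult (mult a x) y\<close>, in
  \<open>y\<close> at 0.\<close>

lemma translation_derivative_frame:
  "frechet_derivative (mult a) (at x) (frame x v) = frame (mult a x) v"
proof -
  have "((\<lambda>y. mult a (mult x y)) has_derivative (\<lambda>v. frechet_derivative (mult a) (at x) (frame x v))) (at 0)"
    using has_derivative_compose[OF frame_has_derivative[of x], of "mult a"] translation_has_derivative[of a x]
    by (simp add: mult_0_right)
  then have "(mult (mult a x) has_derivative (\<lambda>v. frechet_derivative (mult a) (at x) (frame x v))) (at 0)"
    by (simp only: mult_assoc[symmetric])
  then show ?thesis unfolding frame_def[of "mult a x"] by (rule frechet_derivative_eqI[symmetric])
qed

lemma frame_0: "frame 0 v = v"
proof -
  have "mult 0 = (\<lambda>x. x)" by (auto simp: mult_0_left)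
  then show ?thesis unfolding frame_def by (simp add: frechet_derivative_ident)
qed

lemma coframe_frame: "coframe x (frame x v) = v"
  using translation_derivative_frame[of "-x" x v] by (simp add: coframe_def mult_minus_left frame_0)

lemma frame_coframe: "frame x (coframe x v) = v"
  using linear_inverse_left[OF linear_coframe[of x] linear_frame[of x]] coframe_frame[of x]
  by (metis comp_apply eq_id_iff)

text \<open>\<open>coframe\<close> is the left Maurer-Cartan form. Its invariance is what turns its
  determinant into a left-invariant density.\<close>

lemma coframe_translation:
  "coframe (mult a x) (frechet_derivative (mult a) (at x) v) = coframe x v"
  using translation_derivative_frame[of a x "coframe x v"] by (simp add: frame_coframe coframe_frame)

text \<open>A ray translated by one of its own points is the same ray with shifted parameter, so its
  velocity can be computed in two ways: rays are integral curves of their own left-invariant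
  fields.\<close>

lemma frame_line: "frame (t *\<^sub>R x) x = x"
proof -
  have "((\<lambda>s. mult (t *\<^sub>R x) (0 + s *\<^sub>R x)) has_vector_derivative frame (t *\<^sub>R x) x) (at 0)"
    using smooth_on_has_vector_derivative_line[OF smooth_translation[of "t *\<^sub>R x"], of 0 x 0]
    by (simp add: frame_def)
  moreover have "((\<lambda>s. mult (t *\<^sub>R x) (0 + s *\<^sub>R x)) has_vector_derivative x) (at 0)"
    unfolding has_vector_derivative_def by (auto simp: mult_line intro!: derivative_eq_intros)
  ultimately show ?thesis using vector_derivative_unique_at by blast
qed

lemma frame_self: "frame x x = x"
  using frame_line[of 1 x] by simp

lemma frame_joint_has_derivative:
  assumes \<alpha>: "(\<alpha> has_derivative \<alpha>') (at z)" and \<gamma>: "(\<gamma> has_derivative \<gamma>') (at z)"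
  shows "((\<lambda>z. frame (\<alpha> z) (\<gamma> z)) has_derivative
    (\<lambda>h. frechet_derivative (\<lambda>y. frame y (\<gamma> z)) (at (\<alpha> z)) (\<alpha>' h) + frame (\<alpha> z) (\<gamma>' h))) (at z)"
proof -
  define G where "G = (\<lambda>(y, v). frame y v)"
  have G: "smooth_on UNIV G"
    unfolding G_def case_prod_unfold
    by (intro smooth_frame smooth_on_bounded_linear bounded_linear_fst bounded_linear_snd)
  let ?G' = "frechet_derivative G (at (\<alpha> z, \<gamma> z))"
  have G': "(G has_derivative ?G') (at (\<alpha> z, \<gamma> z))"
    using smooth_on_has_derivative[OF G] by simp
  have 1: "?G' (h, 0) = frechet_derivative (\<lambda>y. frame y (\<gamma> z)) (at (\<alpha> z)) h" for h
  proof -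
    have "((\<lambda>y. G (y, \<gamma> z)) has_derivative (\<lambda>h. ?G' (h, 0))) (at (\<alpha> z))"
      by (rule has_derivative_compose[where f = "\<lambda>y. (y, \<gamma> z)" and g = G, OF _ G'])
         (auto intro!: derivative_eq_intros)
    then have "((\<lambda>y. frame y (\<gamma> z)) has_derivative (\<lambda>h. ?G' (h, 0))) (at (\<alpha> z))" by (simp add: G_def)
    then show ?thesis by (rule frechet_derivative_eqI[symmetric])
  qed
  have 2: "?G' (0, k) = frame (\<alpha> z) k" for k
  proof -
    have "((\<lambda>v. G (\<alpha> z, v)) has_derivative (\<lambda>h. ?G' (0, h))) (at (\<gamma> z))"
      by (rule has_derivative_compose[where f = "\<lambda>y. (\<alpha> z, y)" and g = G, OF _ G'])
         (auto intro!: derivative_eq_intros)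
    then have "(frame (\<alpha> z) has_derivative (\<lambda>h. ?G' (0, h))) (at (\<gamma> z))" by (simp add: G_def)
    moreover have "(frame (\<alpha> z) has_derivative frame (\<alpha> z)) (at (\<gamma> z))"
      using linear_frame by (simp add: linear_imp_has_derivative)
    ultimately show ?thesis using has_derivative_unique by metis
  qed
  have "?G' (h, k) = frechet_derivative (\<lambda>y. frame y (\<gamma> z)) (at (\<alpha> z)) h + frame (\<alpha> z) k" for h k
    using linear_add[OF has_derivative_linear[OF G'], of "(h, 0)" "(0, k)"] by (simp add: 1 2)
  moreover have "((\<lambda>z. G (\<alpha> z, \<gamma> z)) has_derivative (\<lambda>h. ?G' (\<alpha>' h, \<gamma>' h))) (at z)"
    by (rule has_derivative_compose[where f = "\<lambda>z. (\<alpha> z, \<gamma> z)" and g = G, OF _ G'])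
       (intro has_derivative_Pair \<alpha> \<gamma>)
  ultimately show ?thesis by (simp add: G_def)
qed

lemma frame_field_has_derivative:
  "((\<lambda>y. frame y w) has_derivative frechet_derivative (\<lambda>y. frame y w) (at z)) (at z)"
  by (intro smooth_on_has_derivative[OF smooth_frame] smooth_ident smooth_on_const UNIV_I)

lemma smooth_field: "smooth_on UNIV F \<Longrightarrow> smooth_on UNIV (field v F)"
proof -
  assume F: "smooth_on UNIV F"
  have "smooth_on UNIV (\<lambda>x. (x, frame x v))"
    by (intro smooth_on_Pair smooth_ident smooth_frame smooth_on_const open_UNIV)
  from smooth_on_compose[OF smooth_on_frechet_derivative_joint[OF F] this open_UNIV]
  show ?thesis by (simp add: field_def[abs_def])
qed

text \<open>Both orders of application produce the second derivative of \<open>F\<close> on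
  \<open>frame x v\<close> and \<open>frame x w\<close>. These terms cancel by symmetry, and only
  the derivatives of the two fields remain.\<close>

lemma field_commutator:
  assumes F: "smooth_on UNIV F"
  shows "field v (field w F) x - field w (field v F) x = frechet_derivative F (at x) (commutator v w x)"
proof -
  let ?F' = "\<lambda>y. frechet_derivative F (at y)"
  define D2 where "D2 u h = frechet_derivative (\<lambda>y. ?F' y u) (at x) h" for u h
  have lin: "linear (?F' x)"
    using smooth_on_has_derivative[OF F] has_derivative_linear by blast
  have *: "field v (field w F) x = D2 (frame x w) (frame x v)
      + ?F' x (frechet_derivative (\<lambda>y. frame y w) (at x) (frame x v))" for v w
  proof -
    define G where "G = (\<lambda>(y, u). ?F' y u)"
    have G: "smooth_on UNIV G"
      unfolding G_def using smooth_on_frechet_derivative_joint[OF F] .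
    let ?G' = "frechet_derivative G (at (x, frame x w))"
    have G': "(G has_derivative ?G') (at (x, frame x w))"
      using smooth_on_has_derivative[OF G] by simp
    have "((\<lambda>y. G (y, frame x w)) has_derivative (\<lambda>h. ?G' (h, 0))) (at x)"
      by (rule has_derivative_compose[where f = "\<lambda>y. (y, frame x w)" and g = G, OF _ G'])
         (auto intro!: derivative_eq_intros)
    then have "((\<lambda>y. ?F' y (frame x w)) has_derivative (\<lambda>h. ?G' (h, 0))) (at x)" by (simp add: G_def)
    then have 1: "?G' (h, 0) = D2 (frame x w) h" for h
      unfolding D2_def by (rule frechet_derivative_eqI[symmetric])
    have "((\<lambda>u. G (x, u)) has_derivative (\<lambda>h. ?G' (0, h))) (at (frame x w))"
      by (rule has_derivative_compose[where f = "\<lambda>y. (x, y)" and g = G, OF _ G'])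
         (auto intro!: derivative_eq_intros)
    moreover have "((\<lambda>u. G (x, u)) has_derivative ?F' x) (at (frame x w))"
      using lin by (simp add: G_def linear_imp_has_derivative)
    ultimately have 2: "?G' (0, k) = ?F' x k" for k
      using has_derivative_unique by metis
    have "((\<lambda>y. G (y, frame y w)) has_derivative
        (\<lambda>h. ?G' (h, frechet_derivative (\<lambda>y. frame y w) (at x) h))) (at x)"
      by (rule has_derivative_compose[where f = "\<lambda>y. (y, frame y w)" and g = G, OF _ G'])
         (intro has_derivative_Pair has_derivative_ident frame_field_has_derivative)
    then have "(field w F has_derivative
        (\<lambda>h. ?G' (h, frechet_derivative (\<lambda>y. frame y w) (at x) h))) (at x)"
      by (simp add: G_def field_def[abs_def])
    then have "frechet_derivative (field w F) (at x) h = ?G' (h, frechet_derivative (\<lambda>y. frame y w) (at x) h)" for h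
      by (rule frechet_derivative_eqI)
    moreover have "?G' (h, k) = D2 (frame x w) h + ?F' x k" for h k
      using linear_add[OF has_derivative_linear[OF G'], of "(h, 0)" "(0, k)"] by (simp add: 1 2)
    ultimately show ?thesis by (simp add: field_def)
  qed
  have "D2 (frame x w) (frame x v) = D2 (frame x v) (frame x w)"
    unfolding D2_def using second_derivative_symmetric[OF F] .
  then show ?thesis
    by (simp add: * commutator_def linear_diff[OF lin])
qed

lemma field_translation:
  assumes F: "smooth_on UNIV F"
  shows "field v (\<lambda>y. F (mult a y)) x = field v F (mult a x)"
proof -
  have "((\<lambda>y. F (mult a y)) has_derivative
      (\<lambda>h. frechet_derivative F (at (mult a x)) (frechet_derivative (mult a) (at x) h))) (at x)"
    using has_derivative_compose[OF translation_has_derivative smooth_on_has_derivative[OF F UNIV_I]] .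
  from frechet_derivative_eqI[OF this] show ?thesis
    unfolding field_def by (simp add: translation_derivative_frame)
qed

text \<open>Fields commute with left translations. Hence testing the commutator at \<open>x\<close>
  on a coordinate function amounts to testing the commutator at 0 on the translate of that function,
  whose derivative at 0 is \<open>frame x\<close> followed by the coordinate.\<close>

lemma commutator_left_invariant: "commutator v w x = frame x (bracket v w)"
proof (rule euclidean_eqI)
  fix b :: 'e
  let ?F = "\<lambda>y. y \<bullet> b" and ?G = "\<lambda>y. mult x y \<bullet> b"
  have D: "frechet_derivative ?F (at y) = ?F" for y
    by (simp add: frechet_derivative_at[symmetric] bounded_linear_imp_has_derivative bounded_linear_inner_left)
  have F: "smooth_on UNIV ?F"
    by (intro smooth_on_bounded_linear bounded_linear_inner_left)
  have G: "smooth_on UNIV ?G"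
    by (rule smooth_on_linear_compose[OF open_UNIV bounded_linear_inner_left smooth_translation])
  have *: "field v ?G = (\<lambda>y. field v ?F (mult x y))" for v
    using field_translation[OF F] by blast
  have "field v (field w ?G) 0 - field w (field v ?G) 0
      = field v (field w ?F) x - field w (field v ?F) x"
    unfolding * by (simp add: field_translation[OF smooth_field[OF F]] mult_0_right)
  then have "frechet_derivative ?G (at 0) (bracket v w) = commutator v w x \<bullet> b"
    using field_commutator[OF F, of v w x] field_commutator[OF G, of v w 0] by (simp add: D bracket_def)
  moreover have "frechet_derivative ?G (at 0) (bracket v w) = frame x (bracket v w) \<bullet> b"
    by (rule frechet_derivative_eqI[OF bounded_linear.has_derivative[OF bounded_linear_inner_left frame_has_derivative]])
  ultimately show "commutator v w x \<bullet> b = frame x (bracket v w) \<bullet> b"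
    by simp
qed

lemma field_bracket:
  assumes F: "smooth_on UNIV F"
  shows "field (bracket v w) F x = field v (field w F) x - field w (field v F) x"
  using field_commutator[OF F] by (simp add: field_def commutator_left_invariant)

text \<open>Coordinate functions suffice as tests because \<open>frame 0\<close> is the identity.
  This provides uniqueness for the definite description behind \<open>lie_bracket\<close>.\<close>

lemma field_determines_vector:
  assumes "\<And>F. smooth_on UNIV F \<Longrightarrow> field u F 0 = field u' F 0"
  shows "u = u'"
proof (rule euclidean_eqI)
  fix b :: 'e
  let ?F = "\<lambda>y. y \<bullet> b"
  have D: "frechet_derivative ?F (at y) = ?F" for y
    by (simp add: frechet_derivative_at[symmetric] bounded_linear_imp_has_derivative bounded_linear_inner_left)
  have "smooth_on UNIV ?F"
    by (intro smooth_on_bounded_linear bounded_linear_inner_left)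
  from assms[OF this] show "u \<bullet> b = u' \<bullet> b" by (simp add: field_def D frame_0)
qed

lemma linear_bracket: "linear (bracket x)"
proof -
  note der = frame_field_has_derivative
  have 1: "frechet_derivative (\<lambda>y. frame y (v + w)) (at 0) =
      (\<lambda>h. frechet_derivative (\<lambda>y. frame y v) (at 0) h + frechet_derivative (\<lambda>y. frame y w) (at 0) h)" for v w
    using has_derivative_add[OF der der] unfolding linear_add[OF linear_frame, symmetric]
    by (rule frechet_derivative_at[symmetric])
  have 2: "frechet_derivative (\<lambda>y. frame y (c *\<^sub>R v)) (at 0) =
      (\<lambda>h. c *\<^sub>R frechet_derivative (\<lambda>y. frame y v) (at 0) h)" for v c
    using has_derivative_scaleR_right[OF der] unfolding linear_scale[OF linear_frame, symmetric]
    by (rule frechet_derivative_at[symmetric])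
  have lin: "linear (frechet_derivative (\<lambda>y. frame y x) (at 0))"
    using der has_derivative_linear by blast
  show ?thesis
    by (rule linearI)
       (simp_all add: bracket_def commutator_def frame_0 1 2 linear_add[OF lin] linear_scale[OF lin] scaleR_diff_right)
qed

text \<open>
  Together with \<open>frame (t *\<^sub>R x) x = x\<close>, the left invariance of commutators turns the
  evolution of the coframe along a ray into a linear differential equation (the one solved by
  \<open>(1 - exp (- ad x)) / ad x\<close>).
\<close>

lemma coframe_line_has_derivative:
  "((\<lambda>t. t *\<^sub>R coframe (t *\<^sub>R x) w) has_vector_derivative w - bracket x (t *\<^sub>R coframe (t *\<^sub>R x) w)) (at t)"
proof -
  let ?y = "t *\<^sub>R x"
  define u where "u s = coframe (s *\<^sub>R x) w" for s
  define u' where "u' = frechet_derivative (\<lambda>y. coframe y w) (at ?y) x"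
  define D where "D v h = frechet_derivative (\<lambda>y. frame y v) (at ?y) h" for v h
  have Dlin: "linear (D v)" for v
    unfolding D_def by (rule has_derivative_linear[OF frame_field_has_derivative])
  have u: "(u has_vector_derivative u') (at t)"
    using smooth_on_has_vector_derivative_line[of "\<lambda>y. coframe y w" 0 x t]
      smooth_coframe[OF smooth_ident smooth_on_const[of _ w]]
    by (simp add: u_def[abs_def] u'_def)
  \<comment> \<open>The vector \<open>frame (s *\<^sub>R x) (u s)\<close> is constantly
    \<open>w\<close>; its derivative along the ray is a first relation for
    \<open>u'\<close>.\<close>
  have "((\<lambda>s. frame (s *\<^sub>R x) (u s)) has_derivative (\<lambda>h. D (u t) (h *\<^sub>R x) + frame ?y (h *\<^sub>R u'))) (at t)"
    unfolding D_def
    by (rule frame_joint_has_derivative)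
       (use u in \<open>auto simp: has_vector_derivative_def intro!: derivative_eq_intros\<close>)
  moreover have "(\<lambda>s. frame (s *\<^sub>R x) (u s)) = (\<lambda>s. w)"
    by (simp add: u_def frame_coframe)
  ultimately have "((\<lambda>s. w) has_derivative (\<lambda>h. D (u t) (h *\<^sub>R x) + frame ?y (h *\<^sub>R u'))) (at t)" by simp
  from fun_cong[OF has_derivative_unique[OF this has_derivative_const], of 1]
  have 1: "D (u t) x + frame ?y u' = 0" by simp
  \<comment> \<open>The identity \<open>frame y y = y\<close>, differentiated in the direction
    \<open>w\<close>, expresses the variation of the field of \<open>x\<close> in this direction
    through \<open>frame\<close> itself.\<close>
  have "((\<lambda>y. frame y y) has_derivative (\<lambda>h. D ?y h + frame ?y h)) (at ?y)"
    unfolding D_def by (rule frame_joint_has_derivative) (auto intro!: derivative_eq_intros)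
  then have "((\<lambda>y. y) has_derivative (\<lambda>h. D ?y h + frame ?y h)) (at ?y)" by (simp add: frame_self)
  from fun_cong[OF has_derivative_unique[OF this has_derivative_ident], of w]
  have "D ?y w + frame ?y w = w" .
  moreover have "D (t *\<^sub>R x) w = t *\<^sub>R D x w"
  proof -
    have "((\<lambda>y. frame y x) has_derivative D x) (at ?y)"
      unfolding D_def by (rule frame_field_has_derivative)
    from has_derivative_scaleR_right[OF this, of t]
    have "((\<lambda>y. frame y (t *\<^sub>R x)) has_derivative (\<lambda>h. t *\<^sub>R D x h)) (at ?y)"
      by (simp add: linear_scale[OF linear_frame])
    then show ?thesis unfolding D_def[of "t *\<^sub>R x"] by (rule frechet_derivative_eqI)
  qed
  ultimately have 2: "t *\<^sub>R D x w = w - frame ?y w" by (simp add: algebra_simps)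
  \<comment> \<open>At \<open>?y\<close> the field of \<open>x\<close> has the value
    \<open>x\<close> and the field of \<open>u t\<close> has the value \<open>w\<close>, so the
    commutator formula involves just the two derivatives that are to be eliminated.\<close>
  have "frame ?y (bracket x (u t)) = D (u t) x - D x w"
    unfolding commutator_left_invariant[symmetric]
    by (simp add: commutator_def D_def frame_line u_def frame_coframe)
  with 1 have "frame ?y u' = - (frame ?y (bracket x (u t)) + D x w)"
    by (simp add: eq_neg_iff_add_eq_0 add.commute)
  \<comment> \<open>The factor \<open>t\<close> makes the second relation applicable to
    \<open>D x w\<close>. The resulting equation is singular at 0 for \<open>u\<close> but regular
    for \<open>t *\<^sub>R u t\<close>, hence the form of the statement.\<close>
  then have "t *\<^sub>R frame ?y u' = frame ?y w - w - t *\<^sub>R frame ?y (bracket x (u t))"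
    using 2 by (simp add: scaleR_add_right scaleR_diff_right)
  then have "frame ?y (t *\<^sub>R u') = frame ?y (w - u t - t *\<^sub>R bracket x (u t))"
    by (simp add: linear_diff[OF linear_frame] linear_scale[OF linear_frame] u_def frame_coframe)
  then have "t *\<^sub>R u' = w - u t - t *\<^sub>R bracket x (u t)"
    by (metis coframe_frame)
  then have "t *\<^sub>R u' + u t = w - bracket x (t *\<^sub>R u t)"
    by (simp add: linear_scale[OF linear_bracket])
  moreover have "((\<lambda>t. t *\<^sub>R u t) has_vector_derivative t *\<^sub>R u' + u t) (at t)"
    using has_vector_derivative_scaleR[OF DERIV_ident u] by (simp add: add.commute)
  ultimately show ?thesis
    by (simp add: u_def[abs_def])
qed

text \<open>Along the ray, the difference \<open>z\<close> of both sides times \<open>t\<close>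
  solves \<open>z' = - bracket (L x) z\<close> because \<open>L\<close> respects brackets. The
  factor \<open>t\<close> gives \<open>z 0 = 0\<close>, so \<open>z\<close> vanishes, and
  \<open>t = 1\<close> is the claim.\<close>

lemma coframe_equivariant:
  assumes L: "linear L" "bij L" and morphism: "\<And>v w. L (bracket v w) = bracket (L v) (L w)"
  shows "coframe (L x) (L w) = L (coframe x w)"
proof -
  define z where "z t = t *\<^sub>R coframe (t *\<^sub>R L x) (L w) - L (t *\<^sub>R coframe (t *\<^sub>R x) w)" for t
  have bl: "bounded_linear L" using L(1) linear_conv_bounded_linear by blast
  have z: "(z has_vector_derivative - bracket (L x) (z t)) (at t)" for t
  proof -
    have "(z has_vector_derivative (L w - bracket (L x) (t *\<^sub>R coframe (t *\<^sub>R L x) (L w)))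
        - L (w - bracket x (t *\<^sub>R coframe (t *\<^sub>R x) w))) (at t)"
      unfolding z_def[abs_def]
      by (intro has_vector_derivative_diff coframe_line_has_derivative
          bounded_linear.has_vector_derivative[OF bl])
    then show ?thesis
      by (simp add: z_def linear_diff[OF L(1)] morphism linear_diff[OF linear_bracket])
  qed
  obtain K where K: "\<And>v. norm (bracket (L x) v) \<le> K * norm v"
    using linear_bounded[OF linear_bracket] by blast
  \<comment> \<open>Gronwall's argument: the derivative of \<open>z t \<bullet> z t\<close> is at
    most \<open>2 * K * (z t \<bullet> z t)\<close>, so with this weight \<open>g\<close> cannot
    rise above its initial value 0.\<close>
  define g where "g t = (z t \<bullet> z t) * exp (- (2 * K * t))" for t
  have g: "(g has_real_derivative (- 2 * (z t \<bullet> bracket (L x) (z t)) - 2 * K * (z t \<bullet> z t)) * exp (- (2 * K * t))) (at t)" for t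
  proof -
    have "((\<lambda>t. z t \<bullet> z t) has_real_derivative (z t \<bullet> (- bracket (L x) (z t)) + (- bracket (L x) (z t)) \<bullet> z t)) (at t)"
    proof -
      note zd = z[unfolded has_vector_derivative_def, of t]
      have "(\<lambda>h. z t \<bullet> (h *\<^sub>R - bracket (L x) (z t)) + (h *\<^sub>R - bracket (L x) (z t)) \<bullet> z t)
        = (*) (z t \<bullet> (- bracket (L x) (z t)) + (- bracket (L x) (z t)) \<bullet> z t)"
        by (rule ext) (simp add: algebra_simps)
      with has_derivative_inner[OF zd zd] show ?thesis by (simp add: has_field_derivative_def)
    qed
    then have "((\<lambda>t. z t \<bullet> z t) has_real_derivative (- 2 * (z t \<bullet> bracket (L x) (z t)))) (at t)"
      by (simp add: inner_commute)
    from this show ?thesis unfolding g_def[abs_def]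
      by (auto intro!: derivative_eq_intros simp: algebra_simps)
  qed
  have "g 1 \<le> g 0"
  proof (rule DERIV_nonpos_imp_nonincreasing[of 0 1 g])
    fix t :: real
    have "- (z t \<bullet> bracket (L x) (z t)) \<le> norm (z t) * norm (bracket (L x) (z t))"
      using Cauchy_Schwarz_ineq2[of "z t" "bracket (L x) (z t)"] by linarith
    also have "\<dots> \<le> norm (z t) * (K * norm (z t))" using K by (intro mult_left_mono) auto
    also have "\<dots> = K * (z t \<bullet> z t)" by (simp add: power2_norm_eq_inner[symmetric] power2_eq_square)
    finally have "(- 2 * (z t \<bullet> bracket (L x) (z t)) - 2 * K * (z t \<bullet> z t)) * exp (- (2 * K * t)) \<le> 0"
      by (intro mult_nonpos_nonneg) auto
    with g show "\<exists>y. (g has_real_derivative y) (at t) \<and> y \<le> 0" by blast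
  qed simp
  moreover have "g 0 = 0" by (simp add: g_def z_def linear_0[OF L(1)])
  ultimately have "z 1 \<bullet> z 1 \<le> 0" by (simp add: g_def mult_le_0_iff not_le[symmetric])
  then have "z 1 = 0" by (metis inner_gt_zero_iff not_le)
  then show ?thesis by (simp add: z_def)
qed

end

subsection \<open>Determinants and change of variables on Euclidean spaces\<close>

text \<open>
  The library states determinants and the change of variables theorem for \<open>real ^ 'n\<close> only. The
  following index type identifies any Euclidean space with such a type.
\<close>

typedef (overloaded) 'e basis_index = "Basis :: 'e::euclidean_space set"
  by (rule nonempty_Basis[unfolded ex_in_conv[symmetric]])

instance basis_index :: (euclidean_space) finite
proof
  have "(UNIV :: 'a basis_index set) = Abs_basis_index ` Basis"
    using type_definition.Abs_image[OF type_definition_basis_index] by metis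
  then show "finite (UNIV :: 'a basis_index set)" by (metis finite_Basis finite_imageI)
qed

text \<open>Change of variables is stated over well-ordered finite index types; any numbering of the
  basis provides such an order.\<close>

instantiation basis_index :: (euclidean_space) wellorder
begin

definition less_eq_basis_index :: "'a basis_index \<Rightarrow> 'a basis_index \<Rightarrow> bool" where
  "x \<le> y \<longleftrightarrow> to_nat_on Basis (Rep_basis_index x) \<le> to_nat_on Basis (Rep_basis_index y)"

definition less_basis_index :: "'a basis_index \<Rightarrow> 'a basis_index \<Rightarrow> bool" where
  "x < y \<longleftrightarrow> to_nat_on Basis (Rep_basis_index x) < to_nat_on Basis (Rep_basis_index y)"

instance
proof
  fix x y z :: "'a basis_index"
  show "x = y" if "x \<le> y" "y \<le> x"
  proof -
    have "inj_on (to_nat_on (Basis :: 'a set)) Basis"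
      by (intro inj_on_to_nat_on countable_finite finite_Basis)
    then show ?thesis
      using that Rep_basis_index[of x] Rep_basis_index[of y]
      unfolding less_eq_basis_index_def by (metis Rep_basis_index_inject inj_onD order_antisym)
  qed
  fix P :: "'a basis_index \<Rightarrow> bool" and a
  assume step: "\<And>x. (\<And>y. y < x \<Longrightarrow> P y) \<Longrightarrow> P x"
  show "P a"
    by (induction a rule: measure_induct_rule[where f = "\<lambda>x. to_nat_on Basis (Rep_basis_index x)"])
       (rule step, simp add: less_basis_index_def)
qed (auto simp: less_eq_basis_index_def less_basis_index_def)

end

definition of_coords :: "real ^ 'e basis_index \<Rightarrow> 'e::euclidean_space" where
  "of_coords x = (\<Sum>i\<in>UNIV. (x $ i) *\<^sub>R Rep_basis_index i)"

definition coords :: "'e::euclidean_space \<Rightarrow> real ^ 'e basis_index" where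
  "coords v = (\<chi> i. v \<bullet> Rep_basis_index i)"

definition linear_det :: "('e::euclidean_space \<Rightarrow> 'e) \<Rightarrow> real" where
  "linear_det f = det (matrix (\<lambda>x. coords (f (of_coords x))))"

lemma bij_betw_Rep_basis_index: "bij_betw Rep_basis_index UNIV (Basis :: 'e::euclidean_space set)"
  using type_definition.Rep_range[OF type_definition_basis_index]
  by (auto simp: bij_betw_def inj_on_def Rep_basis_index_inject)

lemma Rep_basis_index_inner:
  "Rep_basis_index i \<bullet> Rep_basis_index j = (if i = j then 1 else 0)"
  using inner_Basis[OF Rep_basis_index Rep_basis_index, of i j] by (auto simp: Rep_basis_index_inject)

lemma linear_of_coords: "linear of_coords"
  by (rule linearI) (auto simp: of_coords_def scaleR_add_left sum.distrib scaleR_sum_right)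

lemma linear_coords: "linear coords"
  by (rule linearI) (auto simp: coords_def vec_eq_iff inner_add_left)

lemma of_coords_inner: "of_coords x \<bullet> Rep_basis_index i = x $ i"
proof -
  have "of_coords x \<bullet> Rep_basis_index i = (\<Sum>j\<in>UNIV. if j = i then x $ j else 0)"
    unfolding of_coords_def inner_sum_left by (rule sum.cong) (auto simp: Rep_basis_index_inner)
  then show ?thesis by simp
qed

lemma coords_of_coords [simp]: "coords (of_coords x) = x"
  by (simp add: coords_def of_coords_inner vec_eq_iff)

lemma of_coords_coords [simp]: "of_coords (coords v) = v"
proof -
  have "of_coords (coords v) = (\<Sum>b\<in>Basis. (v \<bullet> b) *\<^sub>R b)"
    unfolding of_coords_def coords_def
    using sum.reindex_bij_betw[OF bij_betw_Rep_basis_index, of "\<lambda>b. (v \<bullet> b) *\<^sub>R b"] by simp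
  then show ?thesis by (simp add: euclidean_representation)
qed

lemma continuous_on_of_coords: "continuous_on S of_coords"
  using linear_of_coords linear_continuous_on linear_conv_bounded_linear by blast

lemma continuous_on_coords: "continuous_on S coords"
  using linear_coords linear_continuous_on linear_conv_bounded_linear by blast

lemma borel_measurable_of_coords [measurable]: "of_coords \<in> borel_measurable borel"
  by (rule borel_measurable_continuous_onI[OF continuous_on_of_coords])

text \<open>\<open>lborel\<close> is determined by its values on boxes, and \<open>of_coords\<close>
  matches boxes with boxes of the same side lengths.\<close>

lemma lborel_distr_of_coords: "lborel = distr lborel borel (of_coords :: real ^ 'e basis_index \<Rightarrow> 'e::euclidean_space)"
proof (rule lborel_eqI)
  have range: "range Rep_basis_index = (Basis :: 'e set)"
    using bij_betw_imp_surj_on[OF bij_betw_Rep_basis_index] .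
  fix l u :: 'e
  assume lu: "\<And>b. b \<in> Basis \<Longrightarrow> l \<bullet> b \<le> u \<bullet> b"
  have "of_coords -` box l u = box (coords l) (coords u)"
  proof (rule set_eqI)
    fix x :: "real ^ 'e basis_index"
    have "x \<in> of_coords -` box l u \<longleftrightarrow>
        (\<forall>i. l \<bullet> Rep_basis_index i < x $ i \<and> x $ i < u \<bullet> Rep_basis_index i)"
      unfolding vimage_def mem_Collect_eq mem_box range[symmetric] by (simp add: of_coords_inner)
    then show "x \<in> of_coords -` box l u \<longleftrightarrow> x \<in> box (coords l) (coords u)"
      by (simp add: mem_box_cart coords_def)
  qed
  then have "emeasure (distr lborel borel of_coords) (box l u)
      = emeasure lborel (box (coords l) (coords u))"
    by (simp add: emeasure_distr)
  also have "\<dots> = ennreal (\<Prod>b\<in>Basis. (coords u - coords l) \<bullet> b)"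
    by (rule emeasure_lborel_box)
       (use lu[OF Rep_basis_index] in \<open>auto simp: Basis_vec_def inner_axis coords_def\<close>)
  also have "(\<Prod>b\<in>Basis. (coords u - coords l) \<bullet> b) = (\<Prod>i\<in>UNIV. (u - l) \<bullet> Rep_basis_index i)"
  proof -
    have *: "(Basis :: (real ^ 'e basis_index) set) = (\<lambda>i. axis i 1) ` UNIV"
      by (auto simp: Basis_vec_def)
    have "inj (\<lambda>i :: 'e basis_index. axis i (1::real))"
      by (auto simp: inj_on_def axis_eq_axis)
    then show ?thesis unfolding *
      by (simp add: prod.reindex inner_axis coords_def inner_diff_left)
  qed
  also have "\<dots> = (\<Prod>b\<in>Basis. (u - l) \<bullet> b)"
    by (rule prod.reindex_bij_betw[OF bij_betw_Rep_basis_index])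
  finally show "emeasure (distr lborel borel of_coords) (box l u) = ennreal (\<Prod>b\<in>Basis. (u - l) \<bullet> b)" .
qed simp

lemma nn_integral_lborel_coords:
  fixes F :: "'e::euclidean_space \<Rightarrow> ennreal"
  assumes "F \<in> borel_measurable borel"
  shows "(\<integral>\<^sup>+x. F x \<partial>lborel) = (\<integral>\<^sup>+y. F (of_coords y) \<partial>lborel)"
  by (subst lborel_distr_of_coords) (use assms in \<open>simp add: nn_integral_distr\<close>)

lemma linear_det_compose:
  assumes "linear f" "linear g"
  shows "linear_det (\<lambda>x. f (g x)) = linear_det f * linear_det g"
proof -
  have "linear (\<lambda>x. coords (h (of_coords x)))" if "linear h" for h :: "'a \<Rightarrow> 'a"
    using linear_compose[OF linear_compose[OF linear_of_coords that] linear_coords] by (simp add: o_def)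
  from matrix_compose[OF this[OF assms(2)] this[OF assms(1)]]
  show ?thesis by (simp add: linear_det_def o_def det_mul)
qed

lemma linear_det_ident: "linear_det (\<lambda>x :: 'e::euclidean_space. x) = 1"
proof -
  have "matrix (\<lambda>x :: real ^ 'e basis_index. x) = mat 1"
    using matrix_id_mat_1 unfolding id_def .
  then show ?thesis by (simp add: linear_det_def)
qed

lemma linear_det_bij:
  assumes "linear f" "bij f"
  shows "linear_det f \<noteq> 0"
proof -
  have "linear (inv f)" using assms by (simp add: bij_is_inj inj_linear_imp_inv_linear)
  from linear_det_compose[OF assms(1) this] assms(2)
  show ?thesis by (auto simp: bij_is_surj surj_f_inv_f linear_det_ident)
qed

text \<open>The Leibniz formula exhibits the determinant as a polynomial in matrix entries, so its
  continuity in a parameter can be checked one vector at a time.\<close>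

lemma linear_det_entries:
  assumes "linear f"
  shows "linear_det f = (\<Sum>p | p permutes (UNIV :: 'e basis_index set). of_int (sign p)
    * (\<Prod>i\<in>UNIV. f (Rep_basis_index (p i)) \<bullet> (Rep_basis_index i :: 'e::euclidean_space)))"
proof -
  have "of_coords (axis j 1) = Rep_basis_index j" for j :: "'e basis_index"
  proof -
    have "coords (Rep_basis_index j) = axis j 1"
      by (simp add: coords_def axis_def vec_eq_iff Rep_basis_index_inner)
    then show ?thesis by (metis of_coords_coords)
  qed
  then show ?thesis by (simp add: linear_det_def det_def matrix_def coords_def)
qed

lemma continuous_on_linear_det:
  assumes "\<And>x. linear (f x)" "\<And>v. continuous_on S (\<lambda>x. f x v)"
  shows "continuous_on S (\<lambda>x. linear_det (f x))"
  unfolding linear_det_entries[OF assms(1)]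
  by (intro continuous_intros assms(2))

lemma linear_det_diagonal:
  "linear_det (\<lambda>x. \<Sum>b\<in>Basis. (c b * (x \<bullet> b)) *\<^sub>R b) = (\<Prod>b\<in>Basis. c b)"
proof -
  let ?f = "\<lambda>x. \<Sum>b\<in>Basis. (c b * (x \<bullet> b)) *\<^sub>R (b::'a)"
  have *: "?f v \<bullet> b = c b * (v \<bullet> b)" if "b \<in> Basis" for v b
    using that by (simp add: inner_sum_left_Basis)
  let ?M = "matrix (\<lambda>x. coords (?f (of_coords x)))"
  have M: "?M $ i $ j = c (Rep_basis_index i) * (if i = j then 1 else 0)" for i j
    unfolding matrix_def coords_def vec_lambda_beta *[OF Rep_basis_index] of_coords_inner
    by (simp add: axis_def)
  have "det ?M = (\<Prod>i\<in>UNIV. ?M $ i $ i)"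
    by (rule det_diagonal) (simp add: M)
  also have "\<dots> = (\<Prod>i\<in>UNIV. c (Rep_basis_index i))" by (simp add: M)
  also have "\<dots> = (\<Prod>b\<in>Basis. c b)"
    by (rule prod.reindex_bij_betw[OF bij_betw_Rep_basis_index])
  finally show ?thesis by (simp add: linear_det_def)
qed

section \<open>Change of variables over compact sets\<close>

lemma nn_integral_compact_eq_integral:
  fixes f :: "'a::euclidean_space \<Rightarrow> real"
  assumes "compact S" "continuous_on S f" "\<And>x. f x \<ge> 0"
  shows "(\<integral>\<^sup>+x. ennreal (f x) * indicator S x \<partial>lborel) = ennreal (integral S f)"
proof -
  have int: "set_integrable lborel S f"
    unfolding set_integrable_def using borel_integrable_compact[OF assms(1,2)] .
  have "(\<integral>\<^sup>+x. ennreal (f x) * indicator S x \<partial>lborel) = (\<integral>\<^sup>+x. ennreal (indicator S x *\<^sub>R f x) \<partial>lborel)"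
    by (rule nn_integral_cong) (simp split: split_indicator)
  also have "\<dots> = ennreal (integral S f)"
    using int assms(3) by (subst nn_integral_eq_integral)
      (auto simp: set_integrable_def set_lebesgue_integral_def set_borel_integral_eq_integral(2)[OF int, symmetric])
  finally show ?thesis .
qed

lemma integral_change_of_variables_cart:
  fixes g :: "real^'m::{finite,wellorder} \<Rightarrow> real^'m::_" and f h :: "real^'m::_ \<Rightarrow> real"
  assumes S: "compact S" and g: "\<And>x. x \<in> S \<Longrightarrow> (g has_derivative g' x) (at x within S)" "inj_on g S"
    and f: "continuous_on (g ` S) f" and h: "\<And>x. x \<in> S \<Longrightarrow> h x = \<bar>det (matrix (g' x))\<bar> * f (g x)"
  shows "integral (g ` S) f = integral S h"
proof -
  have cg: "continuous_on S g"
    using g(1) has_derivative_continuous continuous_on_eq_continuous_within by blast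
  \<comment> \<open>The change of variables theorem concerns maps into spaces
    \<open>real^'n\<close>, so the scalar integrand passes through \<open>real^1\<close> and
    back.\<close>
  define F where "F x = (vec (f x) :: real^1)" for x
  have F: "continuous_on (g ` S) F"
    unfolding F_def vec_def by (intro continuous_intros f)
  have "integrable lborel (\<lambda>x. indicator (g ` S) x *\<^sub>R F x)"
    using borel_integrable_compact[OF compact_continuous_image[OF cg S] F] .
  then have "integrable lebesgue (\<lambda>x. indicator (g ` S) x *\<^sub>R F x)"
    by (subst integrable_completion) auto
  then have Fint: "F absolutely_integrable_on (g ` S)" by (simp add: set_integrable_def)
  have Seb: "S \<in> sets lebesgue" using S by (simp add: borel_compact)
  from Fint has_absolute_integral_change_of_variables[OF Seb g, of F "integral (g ` S) F"]
  have 1: "(\<lambda>x. \<bar>det (matrix (g' x))\<bar> *\<^sub>R F (g x)) absolutely_integrable_on S"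
    "integral S (\<lambda>x. \<bar>det (matrix (g' x))\<bar> *\<^sub>R F (g x)) = integral (g ` S) F" by auto
  have bl: "bounded_linear (\<lambda>v::real^1. v $ 1)" by (rule bounded_linear_vec_nth)
  have "integral (g ` S) ((\<lambda>v. v $ 1) \<circ> F) = integral S ((\<lambda>v. v $ 1) \<circ> (\<lambda>x. \<bar>det (matrix (g' x))\<bar> *\<^sub>R F (g x)))"
    using 1 Fint by (simp add: integral_linear[OF _ bl] set_lebesgue_integral_eq_integral(1))
  then have "integral (g ` S) f = integral S (\<lambda>x. \<bar>det (matrix (g' x))\<bar> * f (g x))"
    by (simp add: F_def o_def vec_def)
  also have "\<dots> = integral S h" using h by (intro integral_cong) simp
  finally show ?thesis .
qed

text \<open>Continuity is asked of \<open>h\<close> as a whole: in the applications it is a constant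
  multiple of the Haar density, and it is \<open>h\<close> that is integrated over
  \<open>S\<close>.\<close>

lemma nn_integral_change_of_variables_compact:
  fixes g :: "'e::euclidean_space \<Rightarrow> 'e" and f h :: "'e \<Rightarrow> real"
  assumes S: "compact S" and g: "\<And>x. (g has_derivative g' x) (at x)" "inj g"
    and f: "continuous_on UNIV f" "\<And>x. f x \<ge> 0" and h: "continuous_on UNIV h"
    and eq: "\<And>x. h x = \<bar>linear_det (g' x)\<bar> * f (g x)"
  shows "(\<integral>\<^sup>+x. ennreal (f x) * indicator (g ` S) x \<partial>lborel) = (\<integral>\<^sup>+x. ennreal (h x) * indicator S x \<partial>lborel)"
proof -
  let ?g = "\<lambda>x. coords (g (of_coords x))" and ?S = "coords ` S"
  have cg: "continuous_on UNIV g"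
    using g(1) has_derivative_continuous continuous_at_imp_continuous_on by blast
  have img: "?g ` ?S = coords ` (g ` S)" by (auto simp: image_image)
  have mem: "indicator T (of_coords y) = (indicator (coords ` T) y :: ennreal)" for T :: "'e set" and y
    by (auto split: split_indicator simp: image_iff) (metis coords_of_coords)+
  have cS: "compact (coords ` T)" if "compact T" for T :: "'e set"
    using compact_continuous_image[OF continuous_on_coords that] .
  have cgS: "compact (g ` S)"
    using compact_continuous_image[OF continuous_on_subset[OF cg] S] by simp
  have co: "continuous_on T (\<lambda>y. k (of_coords y))" if "continuous_on UNIV k" for T and k :: "'e \<Rightarrow> real"
    using continuous_on_compose2[OF that continuous_on_of_coords] by auto
  have push: "(\<integral>\<^sup>+x. ennreal (k x) * indicator T x \<partial>lborel) = ennreal (integral (coords ` T) (\<lambda>y. k (of_coords y)))"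
    if T: "compact T" and k: "continuous_on UNIV k" "\<And>x. k x \<ge> 0" for T and k :: "'e \<Rightarrow> real"
  proof -
    have [measurable]: "k \<in> borel_measurable borel" "T \<in> sets borel"
      using k(1) T borel_measurable_continuous_onI borel_compact by auto
    have "(\<integral>\<^sup>+x. ennreal (k x) * indicator T x \<partial>lborel)
      = (\<integral>\<^sup>+y. ennreal (k (of_coords y)) * indicator T (of_coords y) \<partial>lborel)"
      by (rule nn_integral_lborel_coords) measurable
    also have "\<dots> = ennreal (integral (coords ` T) (\<lambda>y. k (of_coords y)))"
      unfolding mem by (rule nn_integral_compact_eq_integral[OF cS[OF T] co[OF k(1)] k(2)])
    finally show ?thesis .
  qed
  have blc: "bounded_linear coords" and blo: "bounded_linear of_coords"
    using linear_coords linear_of_coords by (simp_all add: linear_conv_bounded_linear)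
  have "integral (?g ` ?S) (\<lambda>y. f (of_coords y)) = integral ?S (\<lambda>y. h (of_coords y))"
  proof (rule integral_change_of_variables_cart[OF cS[OF S]])
    fix y
    have "((\<lambda>x. g (of_coords x)) has_derivative (\<lambda>v. g' (of_coords y) (of_coords v))) (at y)"
      using has_derivative_compose[OF bounded_linear_imp_has_derivative[OF blo] g(1)] .
    from bounded_linear.has_derivative[OF blc this]
    show "(?g has_derivative (\<lambda>v. coords (g' (of_coords y) (of_coords v)))) (at y within ?S)"
      by (rule has_derivative_at_withinI)
    show "h (of_coords y) = \<bar>det (matrix (\<lambda>v. coords (g' (of_coords y) (of_coords v))))\<bar> * f (of_coords (?g y))"
      by (simp add: eq linear_det_def)
  next
    show "inj_on ?g ?S"
      using g(2) by (auto simp: inj_on_def) (metis of_coords_coords injD)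
  qed (rule co[OF f(1)])
  then show ?thesis
    using push[OF cgS f] push[OF S h] f(2) by (simp add: img eq)
qed

text \<open>Compact sets are stable under intersection, they generate the Borel sets because a
  closed set is the union of its intersections with balls, and balls of finite measure exhaust the
  space.\<close>

lemma measure_eqI_compact:
  fixes M N :: "'e::euclidean_space measure"
  assumes sets: "sets M = sets borel" "sets N = sets borel"
    and eq: "\<And>K. compact K \<Longrightarrow> emeasure M K = emeasure N K"
    and fin: "\<And>K. compact K \<Longrightarrow> emeasure M K \<noteq> \<infinity>"
  shows "M = N"
proof -
  have "sigma_sets UNIV (Collect compact) = sets (borel :: 'e measure)"
  proof (rule antisym)
    show "sigma_sets UNIV (Collect compact) \<subseteq> sets (borel :: 'e measure)"
      by (intro sets.sigma_sets_subset') (auto intro: borel_compact)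
    have "K \<in> sigma_sets UNIV (Collect compact)" if "closed K" for K :: "'e set"
    proof -
      have "K = (\<Union>n. K \<inter> cball 0 (real n))"
        using real_arch_simple by (auto simp: dist_norm)
      moreover have "K \<inter> cball 0 (real n) \<in> sigma_sets UNIV (Collect compact)" for n
        using that by (intro sigma_sets.Basic) (simp add: closed_Int_compact)
      ultimately show ?thesis using sigma_sets.Union by metis
    qed
    then show "sets (borel :: 'e measure) \<subseteq> sigma_sets UNIV (Collect compact)"
      unfolding borel_eq_closed by (auto intro!: sigma_sets_mono)
  qed
  moreover have "(\<Union>n. cball 0 (real n)) = (UNIV :: 'e set)"
    using real_arch_simple by (auto simp: dist_norm)
  ultimately show ?thesis
    using sets eq fin
    by (intro measure_eqI_generator_eq[of "Collect compact" UNIV M N "\<lambda>n. cball 0 (real n)"])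
       (auto simp: Int_stable_def intro: compact_Int)
qed

subsection \<open>Uniqueness of Haar measure\<close>

lemma haar_measureD:
  assumes "haar_measure M"
  shows "sets M = sets borel" "\<And>a. distr M borel (\<lambda>x. a + x) = M"
    "\<And>K. compact K \<Longrightarrow> emeasure M K < \<infinity>" "\<And>U. open U \<Longrightarrow> U \<noteq> {} \<Longrightarrow> emeasure M U > 0"
  using assms by (auto simp: haar_measure_def)

lemma borel_measurable_translation:
  "(\<lambda>x. a + x) \<in> borel_measurable (borel :: 'g::topological_group_add measure)"
  by (intro borel_measurable_continuous_onI continuous_intros)

lemma haar_measure_nn_integral_translation:
  fixes M :: "'g::topological_group_add measure"
  assumes M: "haar_measure M" and F: "F \<in> borel_measurable borel"
  shows "(\<integral>\<^sup>+x. F (a + x) \<partial>M) = (\<integral>\<^sup>+x. F x \<partial>M)"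
proof -
  have "(\<lambda>x. a + x) \<in> measurable M borel"
    using borel_measurable_translation haar_measureD(1)[OF M] by (simp cong: measurable_cong_sets)
  then have "(\<integral>\<^sup>+x. F x \<partial>distr M borel (\<lambda>x. a + x)) = (\<integral>\<^sup>+x. F (a + x) \<partial>M)"
    using F by (simp add: nn_integral_distr)
  then show ?thesis using haar_measureD(2)[OF M] by simp
qed

text \<open>
  The substitution \<open>(x, y) \<mapsto> (- y, x + y)\<close> preserves products of left Haar measures. Applied to
  \<open>F x * indicator V (y + x) / N (V - x)\<close> it separates the variables and gives a factor \<open>K\<close> that
  depends on the second measure only.
\<close>

lemma haar_measure_product_substitution:
  fixes M N :: "'g::{topological_group_add, second_countable_topology} measure"
  assumes M: "haar_measure M" "sigma_finite_measure M" and N: "haar_measure N" "sigma_finite_measure N"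
    and h: "case_prod h \<in> borel_measurable (borel \<Otimes>\<^sub>M borel)"
  shows "(\<integral>\<^sup>+x. \<integral>\<^sup>+y. h x y \<partial>N \<partial>M) = (\<integral>\<^sup>+x. \<integral>\<^sup>+y. h (- y) (x + y) \<partial>N \<partial>M)"
proof -
  interpret pair_sigma_finite M N using M(2) N(2) by (simp add: pair_sigma_finite_def)
  have sM [measurable_cong]: "sets M = sets borel" and sN [measurable_cong]: "sets N = sets borel"
    using M N haar_measureD(1) by auto
  have m: "(\<lambda>x. - x) \<in> borel_measurable (borel :: 'g measure)"
    by (intro borel_measurable_continuous_onI continuous_intros)
  have h' [measurable]: "(\<lambda>z. h (f z) (g z)) \<in> borel_measurable P"
    if "f \<in> borel_measurable P" "g \<in> borel_measurable P" for f g :: "'c \<Rightarrow> 'g" and P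
    using measurable_compose[OF measurable_Pair[OF that] h] by simp
  have [measurable]: "(\<lambda>z. - f z) \<in> borel_measurable P" if "f \<in> borel_measurable P" for f :: "'c \<Rightarrow> 'g" and P
    using measurable_compose[OF that m] .
  have "(\<integral>\<^sup>+x. \<integral>\<^sup>+y. h x y \<partial>N \<partial>M) = (\<integral>\<^sup>+y. \<integral>\<^sup>+x. h x y \<partial>M \<partial>N)"
    by (rule Fubini'[symmetric]) measurable
  also have "\<dots> = (\<integral>\<^sup>+y. \<integral>\<^sup>+x. h (- y + x) y \<partial>M \<partial>N)"
    by (intro nn_integral_cong haar_measure_nn_integral_translation[OF M(1), symmetric]) measurable
  also have "\<dots> = (\<integral>\<^sup>+x. \<integral>\<^sup>+y. h (- y + x) y \<partial>N \<partial>M)"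
    by (rule Fubini') measurable
  also have "\<dots> = (\<integral>\<^sup>+x. \<integral>\<^sup>+y. h (- (x + y) + x) (x + y) \<partial>N \<partial>M)"
    by (intro nn_integral_cong haar_measure_nn_integral_translation[OF N(1), symmetric]) measurable
  also have "\<dots> = (\<integral>\<^sup>+x. \<integral>\<^sup>+y. h (- y) (x + y) \<partial>N \<partial>M)"
    by (simp add: minus_add add.assoc)
  finally show ?thesis .
qed

lemma haar_measure_unique:
  fixes M N :: "'g::{topological_group_add, t2_space, second_countable_topology} measure"
  assumes M: "haar_measure M" "sigma_finite_measure M" and N: "haar_measure N" "sigma_finite_measure N"
    and V: "open V" "V \<noteq> {}" "V \<subseteq> C" "compact C" and F: "F \<in> borel_measurable borel"
  shows "(\<integral>\<^sup>+x. F x \<partial>M) * emeasure N V = emeasure M V * (\<integral>\<^sup>+x. F x \<partial>N)"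
proof -
  \<comment> \<open>The measure of a right translate of \<open>V\<close>. Invariance is known for
    left translations, so \<open>\<phi>\<close> may vary with \<open>x\<close>; positivity and
    finiteness are what make division by it harmless.\<close>
  define \<phi> where "\<phi> x = (\<integral>\<^sup>+t. indicator V (t + x) \<partial>N)" for x
  have sN [measurable_cong]: "sets N = sets borel" using haar_measureD(1)[OF N(1)] .
  have [measurable]: "V \<in> sets borel" using V by simp
  have [measurable]: "F \<in> borel_measurable borel" using F .
  have m: "(\<lambda>x. - x) \<in> borel_measurable (borel :: 'g measure)"
    by (intro borel_measurable_continuous_onI continuous_intros)
  have [measurable]: "(\<lambda>z. - f z) \<in> borel_measurable P" if "f \<in> borel_measurable P" for f :: "'c \<Rightarrow> 'g" and P
    using measurable_compose[OF that m] .
  have \<phi>_eq: "\<phi> x = emeasure N ((\<lambda>t. t + x) -` V)" for x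
  proof -
    have "(\<lambda>t. t + x) -` V \<in> sets N"
      unfolding sN by (intro borel_open open_vimage V continuous_intros)
    then show ?thesis
      by (simp add: \<phi>_def nn_integral_indicator[symmetric] indicator_vimage o_def del: nn_integral_indicator)
  qed
  have \<phi>_pos: "\<phi> x > 0" for x
    unfolding \<phi>_eq
  proof (rule haar_measureD(4)[OF N(1)])
    show "open ((\<lambda>t. t + x) -` V)" by (intro open_vimage V continuous_intros)
    obtain v where "v \<in> V" using V by auto
    then have "v - x \<in> (\<lambda>t. t + x) -` V" by simp
    then show "(\<lambda>t. t + x) -` V \<noteq> {}" by blast
  qed
  have \<phi>_fin: "\<phi> x < \<infinity>" for x
  proof -
    have c: "compact ((\<lambda>t. t - x) ` C)"
      using V by (intro compact_continuous_image continuous_intros)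
    have "(\<lambda>t. t + x) -` V \<subseteq> (\<lambda>t. t - x) ` C"
      using V by (force simp: image_iff)
    then have "\<phi> x \<le> emeasure N ((\<lambda>t. t - x) ` C)"
      unfolding \<phi>_eq using c by (intro emeasure_mono) (auto simp: sN borel_compact)
    also have "\<dots> < \<infinity>" using haar_measureD(3)[OF N(1) c] .
    finally show ?thesis .
  qed
  interpret N: sigma_finite_measure N by fact
  have [measurable]: "\<phi> \<in> borel_measurable borel"
    unfolding \<phi>_def by measurable
  define K where "K = (\<integral>\<^sup>+y. F (- y) / \<phi> (- y) \<partial>N)"
  have *: "(\<integral>\<^sup>+x. F x \<partial>P) = emeasure P V * K"
    if P: "haar_measure P" "sigma_finite_measure P" for P :: "'g measure"
  proof -
    have sP [measurable_cong]: "sets P = sets borel" using haar_measureD(1)[OF P(1)] .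
    have "(\<integral>\<^sup>+x. F x \<partial>P) = (\<integral>\<^sup>+x. F x / \<phi> x * \<phi> x \<partial>P)"
      using \<phi>_pos \<phi>_fin
      by (intro nn_integral_cong) (simp add: ennreal_times_divide[symmetric] ennreal_divide_times less_imp_neq[symmetric] ennreal_divide_self)
    also have "\<dots> = (\<integral>\<^sup>+x. \<integral>\<^sup>+y. F x / \<phi> x * indicator V (y + x) \<partial>N \<partial>P)"
      unfolding \<phi>_def[of "_ :: 'g", abs_def, symmetric]
      by (intro nn_integral_cong) (subst nn_integral_cmult, measurable, simp add: \<phi>_def)
    \<comment> \<open>Under the substitution the argument \<open>y + x\<close> of the indicator
      becomes \<open>(x + y) + - y\<close>, which is \<open>x\<close>; everything else depends on
      \<open>y\<close> only.\<close>
    also have "\<dots> = (\<integral>\<^sup>+x. \<integral>\<^sup>+y. F (- y) / \<phi> (- y) * indicator V ((x + y) + - y) \<partial>N \<partial>P)"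
      by (rule haar_measure_product_substitution[OF P N]) measurable
    also have "\<dots> = (\<integral>\<^sup>+x. \<integral>\<^sup>+y. indicator V x * (F (- y) / \<phi> (- y)) \<partial>N \<partial>P)"
      by (simp add: add.assoc mult.commute)
    also have "\<dots> = (\<integral>\<^sup>+x. indicator V x * K \<partial>P)"
      unfolding K_def by (intro nn_integral_cong nn_integral_cmult) measurable
    also have "\<dots> = emeasure P V * K"
      by (subst nn_integral_multc) auto
    finally show ?thesis .
  qed
  show ?thesis
    unfolding *[OF M] *[OF N] by (simp add: ac_simps)
qed

subsection \<open>The Haar density in exponential coordinates\<close>

context exponential_coordinates
begin

definition haar_density :: "'e \<Rightarrow> real" where
  "haar_density x = \<bar>linear_det (coframe x)\<bar>"

definition haar_coords :: "'e measure" where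
  "haar_coords = density lborel (\<lambda>x. ennreal (haar_density x))"

lemma continuous_haar_density: "continuous_on UNIV haar_density"
  unfolding haar_density_def[abs_def]
  by (intro continuous_intros continuous_on_linear_det linear_coframe
      smooth_on_continuous_on smooth_coframe smooth_ident smooth_on_const)

lemma haar_density_pos: "haar_density x > 0"
proof -
  have "bij (coframe x)"
    using coframe_frame frame_coframe by (intro o_bij[of "frame x"]) auto
  from linear_det_bij[OF linear_coframe this] show ?thesis by (simp add: haar_density_def)
qed

lemma haar_density_nonneg: "haar_density x \<ge> 0"
  by (simp add: haar_density_def)

lemma borel_measurable_haar_density [measurable]: "haar_density \<in> borel_measurable borel"
  using continuous_haar_density by (rule borel_measurable_continuous_onI)

lemma sets_haar_coords [simp, measurable_cong]: "sets haar_coords = sets borel"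
  by (simp add: haar_coords_def)

lemma emeasure_haar_coords:
  "S \<in> sets borel \<Longrightarrow> emeasure haar_coords S = (\<integral>\<^sup>+x. ennreal (haar_density x) * indicator S x \<partial>lborel)"
  by (simp add: haar_coords_def emeasure_density)

lemma emeasure_haar_coords_compact: "compact K \<Longrightarrow> emeasure haar_coords K < \<infinity>"
  using nn_integral_compact_eq_integral[of K haar_density, OF _ _ haar_density_nonneg]
    continuous_on_subset[OF continuous_haar_density]
  by (simp add: emeasure_haar_coords borel_compact)

lemma emeasure_haar_coords_open:
  assumes "open U" "U \<noteq> {}"
  shows "emeasure haar_coords U > 0"
proof -
  have "emeasure haar_coords U \<noteq> 0"
  proof
    assume "emeasure haar_coords U = 0"
    then have "AE x in lborel. ennreal (haar_density x) * indicator U x = 0"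
      using assms by (subst (asm) emeasure_haar_coords, simp, subst (asm) nn_integral_0_iff_AE) auto
    then have "AE x in lborel. x \<notin> U"
      by eventually_elim (use haar_density_pos in \<open>auto split: split_indicator_asm simp: not_le[symmetric] ennreal_eq_0_iff\<close>)
    then have "emeasure lborel U = 0"
      using assms by (subst (asm) AE_iff_measurable[of U]) auto
    moreover obtain x e where "e > 0" "ball x e \<subseteq> U" using assms openE by blast
    moreover have "emeasure lborel (ball x e) \<le> emeasure lborel U"
      using \<open>ball x e \<subseteq> U\<close> assms by (intro emeasure_mono) auto
    moreover have "measure lborel (ball x e) > 0"
      using content_ball_pos \<open>e > 0\<close> by (metis measure_completion lborelD sets_lborel borel_open open_ball)
    ultimately show False by (simp add: measure_def)
  qed
  then show ?thesis by (simp add: zero_less_iff_neq_zero)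
qed

text \<open>Serves left translations with \<open>c = 1\<close> and Lie algebra automorphisms
  \<open>L\<close> with \<open>c = \<bar>linear_det L\<bar>\<close>; in both cases \<open>eq\<close>
  is a pointwise consequence of a property of \<open>coframe\<close>.\<close>

lemma emeasure_haar_coords_image:
  assumes K: "compact K" and g: "\<And>x. (g has_derivative g' x) (at x)" "inj g" and c: "c \<ge> 0"
    and eq: "\<And>x. c * haar_density x = \<bar>linear_det (g' x)\<bar> * haar_density (g x)"
  shows "emeasure haar_coords (g ` K) = ennreal c * emeasure haar_coords K"
proof -
  have "continuous_on UNIV g"
    using g(1) has_derivative_continuous continuous_at_imp_continuous_on by blast
  then have "compact (g ` K)"
    using K compact_continuous_image continuous_on_subset by blast
  then have "emeasure haar_coords (g ` K) = (\<integral>\<^sup>+x. ennreal (haar_density x) * indicator (g ` K) x \<partial>lborel)"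
    by (simp add: emeasure_haar_coords borel_compact)
  also have "\<dots> = (\<integral>\<^sup>+x. ennreal (c * haar_density x) * indicator K x \<partial>lborel)"
    by (rule nn_integral_change_of_variables_compact[OF K g continuous_haar_density haar_density_nonneg _ eq])
       (intro continuous_intros continuous_haar_density)
  also have "\<dots> = (\<integral>\<^sup>+x. ennreal c * (ennreal (haar_density x) * indicator K x) \<partial>lborel)"
    using c haar_density_nonneg by (intro nn_integral_cong) (simp add: ennreal_mult mult.assoc)
  also have "\<dots> = ennreal c * emeasure haar_coords K"
  proof -
    have [measurable]: "K \<in> sets borel" using K by (rule borel_compact)
    show ?thesis by (subst nn_integral_cmult) (measurable, simp add: emeasure_haar_coords)
  qed
  finally show ?thesis .
qed

text \<open>\<open>coframe_translation\<close> factors \<open>coframe x\<close> through the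
  derivative of the translation. Determinants multiply, so the Jacobian cancels against the change
  of density.\<close>

lemma haar_coords_left_invariant: "distr haar_coords borel (mult a) = haar_coords"
proof (rule measure_eqI_compact)
  have cont: "continuous_on UNIV (mult b)" for b
    using smooth_on_continuous_on[OF smooth_translation] .
  have meas: "mult a \<in> measurable haar_coords borel"
    using borel_measurable_continuous_onI[OF cont] by (simp cong: measurable_cong_sets)
  have inv: "mult b (mult (- b) x) = x" "mult (- b) (mult b x) = x" for b x
    by (simp_all add: mult_assoc[symmetric] mult_minus_left mult_minus_right mult_0_left)
  show eq: "emeasure (distr haar_coords borel (mult a)) K = emeasure haar_coords K" if K: "compact K" for K
  proof -
    \<comment> \<open>Rewriting the preimage as an image under the inverse translation gives change
      of variables the form it needs.\<close>
    have "mult a -` K = mult (- a) ` K"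
      by (auto simp: image_iff inv) (metis inv)
    then have "emeasure (distr haar_coords borel (mult a)) K = emeasure haar_coords (mult (- a) ` K)"
      using meas K by (simp add: emeasure_distr borel_compact haar_coords_def)
    also have "\<dots> = ennreal 1 * emeasure haar_coords K"
    proof (rule emeasure_haar_coords_image[OF K])
      show "(mult (- a) has_derivative frechet_derivative (mult (- a)) (at x)) (at x)" for x
        by (rule translation_has_derivative)
      show "inj (mult (- a))" using inv by (metis injI)
      show "1 * haar_density x = \<bar>linear_det (frechet_derivative (mult (- a)) (at x))\<bar> * haar_density (mult (- a) x)" for x
      proof -
        have "coframe x = (\<lambda>v. coframe (mult (- a) x) (frechet_derivative (mult (- a)) (at x) v))"
          by (simp add: coframe_translation)
        then have "linear_det (coframe x) = linear_det (coframe (mult (- a) x)) * linear_det (frechet_derivative (mult (- a)) (at x))"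
          using linear_det_compose[OF linear_coframe has_derivative_linear[OF translation_has_derivative]] by metis
        then show ?thesis by (simp add: haar_density_def abs_mult mult.commute)
      qed
    qed simp
    finally show ?thesis by simp
  qed
  show "emeasure (distr haar_coords borel (mult a)) K \<noteq> \<infinity>" if K: "compact K" for K
    using eq[OF K] emeasure_haar_coords_compact[OF K] by simp
qed simp_all

text \<open>Taking determinants in \<open>coframe (L x) (L w) = L (coframe x w)\<close> and
  cancelling that of \<open>L\<close> shows that \<open>L\<close> preserves the density. What
  remains is the constant Jacobian of \<open>L\<close>.\<close>

lemma haar_coords_morphism:
  assumes L: "linear L" "bij L" and morphism: "\<And>v w. L (bracket v w) = bracket (L v) (L w)"
    and F: "F \<in> borel_measurable borel"
  shows "(\<integral>\<^sup>+x. F x \<partial>haar_coords) = ennreal \<bar>linear_det L\<bar> * (\<integral>\<^sup>+x. F (L x) \<partial>haar_coords)"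
proof -
  have bl: "bounded_linear L" using L(1) linear_conv_bounded_linear by blast
  have meas: "L \<in> measurable haar_coords borel"
    using borel_measurable_continuous_onI[OF linear_continuous_on[OF bl]] by (simp cong: measurable_cong_sets)
  have invariant: "haar_density (L x) = haar_density x" for x
  proof -
    have "linear_det (\<lambda>w. coframe (L x) (L w)) = linear_det (\<lambda>w. L (coframe x w))"
      by (rule arg_cong[where f = linear_det], rule ext) (rule coframe_equivariant[OF L morphism])
    then have "linear_det (coframe (L x)) * linear_det L = linear_det L * linear_det (coframe x)"
      unfolding linear_det_compose[OF linear_coframe L(1)] linear_det_compose[OF L(1) linear_coframe] .
    then have "linear_det (coframe (L x)) = linear_det (coframe x)"
      using linear_det_bij[OF L] by (simp add: mult.commute)
    then show ?thesis by (simp add: haar_density_def)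
  qed
  let ?c = "\<bar>linear_det L\<bar>"
  have eq: "emeasure haar_coords K = emeasure (scale_measure (ennreal ?c) (distr haar_coords borel L)) K"
    if K: "compact K" for K
  proof -
    have invL: "linear (inv L)" using L by (simp add: bij_is_inj inj_linear_imp_inv_linear)
    have "L -` K = inv L ` K" using L(2) by (simp add: bij_vimage_eq_inv_image)
    then have c: "compact (L -` K)"
      using compact_continuous_image[OF linear_continuous_on K] invL linear_conv_bounded_linear by metis
    have "K = L ` (L -` K)" using L(2) by (simp add: bij_is_surj surj_image_vimage_eq)
    then have "emeasure haar_coords K = emeasure haar_coords (L ` (L -` K))" by simp
    also have "\<dots> = ennreal ?c * emeasure haar_coords (L -` K)"
      by (rule emeasure_haar_coords_image[OF c, where g' = "\<lambda>_. L"])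
         (use L bl in \<open>auto simp: bounded_linear_imp_has_derivative bij_is_inj invariant\<close>)
    also have "\<dots> = emeasure (scale_measure (ennreal ?c) (distr haar_coords borel L)) K"
      using meas K by (simp add: emeasure_distr borel_compact haar_coords_def)
    finally show ?thesis .
  qed
  have "haar_coords = scale_measure (ennreal ?c) (distr haar_coords borel L)"
    using eq emeasure_haar_coords_compact by (intro measure_eqI_compact) (auto simp: less_top)
  then have "(\<integral>\<^sup>+x. F x \<partial>haar_coords) = (\<integral>\<^sup>+x. F x \<partial>scale_measure (ennreal ?c) (distr haar_coords borel L))"
    by simp
  also have "\<dots> = ennreal ?c * (\<integral>\<^sup>+x. F (L x) \<partial>haar_coords)"
    using F meas by (simp add: nn_integral_scale_measure nn_integral_distr)
  finally show ?thesis .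
qed

end

subsection \<open>Dilations\<close>

definition diagonal_map :: "('e::euclidean_space \<Rightarrow> real) \<Rightarrow> 'e \<Rightarrow> 'e" where
  "diagonal_map c y = (\<Sum>b\<in>Basis. (c b * (y \<bullet> b)) *\<^sub>R b)"

lemma diagonal_map_inner: "b \<in> Basis \<Longrightarrow> diagonal_map c y \<bullet> b = c b * (y \<bullet> b)"
  by (simp add: diagonal_map_def inner_sum_left_Basis)

lemma diagonal_map_diagonal_map: "diagonal_map c (diagonal_map d y) = diagonal_map (\<lambda>b. c b * d b) y"
  by (rule euclidean_eqI) (simp add: diagonal_map_inner)

lemma linear_diagonal_map: "linear (diagonal_map c)"
  by (rule linearI; rule euclidean_eqI) (simp_all add: diagonal_map_inner inner_add_left algebra_simps)

text \<open>The trace is defined by the standard basis, while \<open>A\<close> is diagonal in an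
  eigenbasis; invariance of the trace under conjugation connects the two.\<close>

lemma linear_trace_commute:
  fixes f g :: "'e::euclidean_space \<Rightarrow> 'e"
  assumes "linear f" "linear g"
  shows "linear_trace (\<lambda>x. f (g x)) = linear_trace (\<lambda>x. g (f x))"
proof -
  have *: "linear_trace (\<lambda>x. f (g x)) = (\<Sum>b\<in>Basis. \<Sum>d\<in>Basis. (g b \<bullet> d) * (f d \<bullet> b))"
    if "linear f" for f g :: "'e \<Rightarrow> 'e"
    unfolding linear_trace_def
    by (subst linear_expand_Basis[OF that]) (simp add: inner_sum_left)
  show ?thesis
    unfolding *[OF assms(1)] *[OF assms(2)] by (subst sum.swap) (simp add: mult.commute)
qed

text \<open>\<open>S\<close> carries the standard basis to a basis of eigenvectors, which need not
  be orthogonal. Conjugation by \<open>S\<close> reduces powers, determinants and derivatives to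
  scalars.\<close>

locale eigenframe =
  fixes A S :: "'e::euclidean_space \<Rightarrow> 'e" and \<mu> :: "'e \<Rightarrow> real"
  assumes linear_A: "linear A" and linear_S: "linear S" and bij_S: "bij S"
    and eigen: "\<And>b. b \<in> Basis \<Longrightarrow> A (S b) = \<mu> b *\<^sub>R S b"

lemma diagonalisable_eigenframe:
  assumes "diagonalisable A"
  obtains S \<mu> where "eigenframe A S \<mu>"
proof -
  obtain B where A: "linear A" and B: "independent B" "span B = UNIV"
    and eig: "\<forall>b\<in>B. \<exists>\<mu>::real. A b = \<mu> *\<^sub>R b"
    using assms by (auto simp: diagonalisable_def)
  have "card B = DIM('a)"
    using dim_eq_card[of B UNIV] B by simp
  then obtain \<beta> where \<beta>: "bij_betw \<beta> (Basis :: 'a set) B"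
    using finite_same_card_bij[OF finite_Basis independent_imp_finite[OF B(1)]] by metis
  define S where "S x = (\<Sum>b\<in>Basis. (x \<bullet> b) *\<^sub>R \<beta> b)" for x :: 'a
  have S: "linear S"
    by (rule linearI) (auto simp: S_def inner_add_left scaleR_add_left sum.distrib scaleR_sum_right)
  have Sb: "S b = \<beta> b" if b: "b \<in> Basis" for b
  proof -
    have "S b = (\<Sum>d\<in>Basis. if b = d then \<beta> d else 0)"
      unfolding S_def by (rule sum.cong) (use b in \<open>auto simp: inner_Basis\<close>)
    then show ?thesis using b by simp
  qed
  have "B \<subseteq> range S"
    using \<beta> Sb by (auto simp: bij_betw_def) (metis rangeI)
  then have "span B \<subseteq> range S"
    by (rule span_minimal) (intro linear_subspace_image S subspace_UNIV)
  then have "surj S" using B by auto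
  then have "bij S"
    using linear_surjective_imp_injective[OF S] by (simp add: bij_def)
  moreover have "\<forall>b\<in>Basis. \<exists>m. A (S b) = m *\<^sub>R S b"
    using eig \<beta> Sb by (auto simp: bij_betw_def)
  ultimately show ?thesis
    using that A S unfolding eigenframe_def by (metis (mono_tags))
qed

context eigenframe
begin

lemma linear_inv_S: "linear (inv S)"
  using linear_S bij_S by (simp add: bij_is_inj inj_linear_imp_inv_linear)

lemma S_inv_S [simp]: "S (inv S x) = x"
  using bij_S by (simp add: bij_is_surj surj_f_inv_f)

lemma inv_S_S [simp]: "inv S (S x) = x"
  using bij_S by (simp add: bij_is_inj inv_f_f)

lemma bounded_linear_S: "bounded_linear S"
  using linear_S by (simp add: linear_conv_bounded_linear)

lemma S_expand: "S y = (\<Sum>b\<in>Basis. (y \<bullet> b) *\<^sub>R S b)"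
  by (rule linear_expand_Basis[OF linear_S])

lemma A_eq: "A (S y) = S (diagonal_map \<mu> y)"
proof -
  have "A (S y) = (\<Sum>b\<in>Basis. (y \<bullet> b) *\<^sub>R A (S b))"
    by (subst S_expand) (simp add: linear_sum[OF linear_A] linear_scale[OF linear_A])
  also have "\<dots> = (\<Sum>b\<in>Basis. (diagonal_map \<mu> y \<bullet> b) *\<^sub>R S b)"
    by (intro sum.cong refl) (simp add: eigen diagonal_map_inner)
  finally show ?thesis by (simp add: S_expand[symmetric])
qed

text \<open>In eigencoordinates the operator series splits into scalar exponential series; for
  positive \<open>r\<close> the factors are \<open>r powr \<mu> b\<close>.\<close>

lemma dilation_eq: "dilation A r (S y) = S (diagonal_map (\<lambda>b. exp (\<mu> b * ln r)) y)"
proof -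
  have iter: "((\<lambda>w. ln r *\<^sub>R A w) ^^ k) (S y) = (\<Sum>b\<in>Basis. ((\<mu> b * ln r) ^ k * (y \<bullet> b)) *\<^sub>R S b)" for k
  proof (induction k)
    case 0
    then show ?case using S_expand[of y] by simp
  next
    case (Suc k)
    have "((\<lambda>w. ln r *\<^sub>R A w) ^^ Suc k) (S y) = ln r *\<^sub>R A (\<Sum>b\<in>Basis. ((\<mu> b * ln r) ^ k * (y \<bullet> b)) *\<^sub>R S b)"
      using Suc by simp
    also have "\<dots> = (\<Sum>b\<in>Basis. (ln r * ((\<mu> b * ln r) ^ k * (y \<bullet> b))) *\<^sub>R A (S b))"
      by (simp add: linear_sum[OF linear_A] linear_scale[OF linear_A] scaleR_sum_right)
    also have "\<dots> = (\<Sum>b\<in>Basis. ((\<mu> b * ln r) ^ Suc k * (y \<bullet> b)) *\<^sub>R S b)"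
      by (intro sum.cong refl) (simp add: eigen mult.commute mult.left_commute)
    finally show ?case .
  qed
  have "(\<lambda>k. \<Sum>b\<in>Basis. (((\<mu> b * ln r) ^ k /\<^sub>R fact k) * (y \<bullet> b)) *\<^sub>R S b) sums
      (\<Sum>b\<in>Basis. (exp (\<mu> b * ln r) * (y \<bullet> b)) *\<^sub>R S b)"
    by (intro sums_sum bounded_linear.sums[OF bounded_linear_scaleR_left] sums_mult2 exp_converges)
  moreover have "(1 / fact k) *\<^sub>R ((\<lambda>w. ln r *\<^sub>R A w) ^^ k) (S y)
      = (\<Sum>b\<in>Basis. (((\<mu> b * ln r) ^ k /\<^sub>R fact k) * (y \<bullet> b)) *\<^sub>R S b)" for k
    unfolding iter scaleR_sum_right by (intro sum.cong refl) (simp add: divide_inverse)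
  ultimately have "dilation A r (S y) = (\<Sum>b\<in>Basis. (exp (\<mu> b * ln r) * (y \<bullet> b)) *\<^sub>R S b)"
    unfolding dilation_def by (simp add: sums_unique[symmetric])
  also have "\<dots> = S (diagonal_map (\<lambda>b. exp (\<mu> b * ln r)) y)"
    by (subst (2) S_expand) (simp add: diagonal_map_inner)
  finally show ?thesis .
qed

lemma dilation_eq': "dilation A r x = S (diagonal_map (\<lambda>b. exp (\<mu> b * ln r)) (inv S x))"
  using dilation_eq[of r "inv S x"] by simp

lemma linear_dilation: "linear (dilation A r)"
  using linear_compose[OF linear_compose[OF linear_inv_S linear_diagonal_map] linear_S]
  by (simp add: o_def dilation_eq'[abs_def])

lemma dilation_dilation: "r > 0 \<Longrightarrow> s > 0 \<Longrightarrow> dilation A r (dilation A s x) = dilation A (r * s) x"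
  by (simp add: dilation_eq' diagonal_map_diagonal_map ln_mult algebra_simps exp_add)

lemma dilation_ln_zero: "ln r = 0 \<Longrightarrow> dilation A r x = x"
  by (simp add: dilation_eq' diagonal_map_def euclidean_representation)

lemma dilation_one: "dilation A 1 x = x"
  by (simp add: dilation_ln_zero)

lemma bij_dilation:
  assumes "r > 0"
  shows "bij (dilation A r)"
proof (rule o_bij[of "dilation A (1 / r)"])
  show "dilation A (1 / r) \<circ> dilation A r = id" "dilation A r \<circ> dilation A (1 / r) = id"
    using assms by (auto simp: dilation_dilation dilation_one)
qed

text \<open>Conjugate to a diagonal map with entries \<open>r powr \<mu> b\<close>, whose product
  has the sum of the eigenvalues as exponent; that sum is the trace of \<open>A\<close>.\<close>

lemma linear_det_dilation:
  assumes "r > 0"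
  shows "linear_det (dilation A r) = r powr linear_trace A"
proof -
  let ?D = "diagonal_map (\<lambda>b. exp (\<mu> b * ln r))"
  have "linear_det S * linear_det (inv S) = 1"
    using linear_det_compose[OF linear_S linear_inv_S] by (simp add: linear_det_ident)
  moreover have "linear_det (dilation A r) = linear_det S * (linear_det ?D * linear_det (inv S))"
    unfolding dilation_eq'[abs_def]
    using linear_det_compose[OF linear_S linear_compose[OF linear_inv_S linear_diagonal_map]]
      linear_det_compose[OF linear_diagonal_map linear_inv_S] by (simp add: o_def)
  ultimately have "linear_det (dilation A r) = linear_det ?D" by (simp add: mult.commute mult.left_commute)
  also have "\<dots> = exp (\<Sum>b\<in>Basis. \<mu> b * ln r)"
    using linear_det_diagonal[of "\<lambda>b. exp (\<mu> b * ln r)"] by (simp add: diagonal_map_def[abs_def] exp_sum)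
  finally have 1: "linear_det (dilation A r) = exp ((\<Sum>b\<in>Basis. \<mu> b) * ln r)"
    by (simp add: sum_distrib_right)
  have "A = (\<lambda>x. S (diagonal_map \<mu> (inv S x)))"
  proof
    fix x show "A x = S (diagonal_map \<mu> (inv S x))" using A_eq[of "inv S x"] by simp
  qed
  then have "linear_trace A = linear_trace (\<lambda>x. S (diagonal_map \<mu> (inv S x)))"
    by (rule arg_cong)
  also have "\<dots> = linear_trace (\<lambda>x. diagonal_map \<mu> x)"
    using linear_trace_commute[OF linear_S linear_compose[OF linear_inv_S linear_diagonal_map]]
    by (simp add: o_def)
  also have "\<dots> = (\<Sum>b\<in>Basis. \<mu> b)"
    by (simp add: linear_trace_def diagonal_map_inner inner_same_Basis)
  finally show ?thesis using 1 assms by (simp add: powr_def)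
qed

text \<open>Coordinatewise this is the rule for differentiating \<open>r powr \<mu> b\<close>. It
  identifies \<open>A\<close> as the generator of the dilations in the parameter
  \<open>ln r\<close>.\<close>

lemma dilation_has_vector_derivative:
  assumes "r > 0"
  shows "((\<lambda>r. dilation A r x) has_vector_derivative (1 / r) *\<^sub>R A (dilation A r x)) (at r)"
proof -
  let ?y = "inv S x"
  have "((\<lambda>r. \<Sum>b\<in>Basis. (exp (\<mu> b * ln r) * (?y \<bullet> b)) *\<^sub>R b) has_vector_derivative
      (\<Sum>b\<in>Basis. (exp (\<mu> b * ln r) * (\<mu> b * (1 / r)) * (?y \<bullet> b)) *\<^sub>R b)) (at r)"
  proof (rule has_vector_derivative_sum)
    fix b :: 'e
    have "((\<lambda>r. exp (\<mu> b * ln r) * (?y \<bullet> b)) has_real_derivative exp (\<mu> b * ln r) * (\<mu> b * (1 / r)) * (?y \<bullet> b)) (at r)"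
      using assms by (auto intro!: derivative_eq_intros)
    from has_vector_derivative_scaleR[OF this has_vector_derivative_const]
    show "((\<lambda>r. (exp (\<mu> b * ln r) * (?y \<bullet> b)) *\<^sub>R b) has_vector_derivative
        (exp (\<mu> b * ln r) * (\<mu> b * (1 / r)) * (?y \<bullet> b)) *\<^sub>R b) (at r)" by simp
  qed
  from bounded_linear.has_vector_derivative[OF bounded_linear_S this]
  have "((\<lambda>r. dilation A r x) has_vector_derivative
      S (\<Sum>b\<in>Basis. (exp (\<mu> b * ln r) * (\<mu> b * (1 / r)) * (?y \<bullet> b)) *\<^sub>R b)) (at r)"
    by (simp add: dilation_eq' diagonal_map_def)
  moreover have "(\<Sum>b\<in>Basis. (exp (\<mu> b * ln r) * (\<mu> b * (1 / r)) * (?y \<bullet> b)) *\<^sub>R b)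
      = (1 / r) *\<^sub>R diagonal_map \<mu> (diagonal_map (\<lambda>b. exp (\<mu> b * ln r)) ?y)"
    unfolding diagonal_map_diagonal_map diagonal_map_def scaleR_sum_right
    by (intro sum.cong refl) (simp add: mult.commute mult.left_commute)
  ultimately show ?thesis
    by (simp add: dilation_eq' A_eq linear_scale[OF linear_S])
qed

lemma continuous_on_dilation: "continuous_on ({0<..} \<times> UNIV) (\<lambda>z. dilation A (fst z) (snd z))"
proof -
  have "bounded_linear (inv S)" using linear_inv_S by (simp add: linear_conv_bounded_linear)
  then show ?thesis
    unfolding dilation_eq' diagonal_map_def
    by (intro bounded_linear.continuous_on[OF bounded_linear_S] continuous_intros
        bounded_linear.continuous_on[of "inv S"]) auto
qed

end

subsection \<open>Homogeneous groups in exponential coordinates\<close>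

context homogeneous_group
begin

abbreviation Log :: "'g \<Rightarrow> 'e" where
  "Log \<equiv> inv Exp"

lemma Exp_Log [simp]: "Exp (Log x) = x"
  using diffeomorphism by (simp add: global_diffeomorphism_def bij_is_surj surj_f_inv_f)

lemma Log_Exp [simp]: "Log (Exp v) = v"
  using diffeomorphism by (simp add: global_diffeomorphism_def bij_is_inj inv_f_f)

lemma Exp_add: "Exp ((s + t) *\<^sub>R v) = Exp (s *\<^sub>R v) + Exp (t *\<^sub>R v)"
  using exponential by (simp add: exponential_map_def)

lemma Exp_0 [simp]: "Exp 0 = 0"
proof -
  have "Exp 0 + Exp 0 = Exp 0 + 0" using Exp_add[of 0 0 0] by simp
  then show ?thesis by (rule add_left_imp_eq)
qed

lemma Log_0 [simp]: "Log 0 = 0"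
  using Log_Exp[of 0] by simp

lemma continuous_Exp: "continuous_on UNIV Exp"
  using diffeomorphism by (simp add: global_diffeomorphism_def)

lemma atlas:
  assumes "(U, \<phi>) \<in> \<A>"
  shows "open U" "open (\<phi> ` U)" "homeomorphism U (\<phi> ` U) \<phi> (inv_into U \<phi>)"
    "smooth_on (Exp -` U) (\<lambda>v. \<phi> (Exp v))" "smooth_on (\<phi> ` U) (\<lambda>a. Log (inv_into U \<phi> a))"
    "open (Exp -` U)"
proof -
  show "open U" "open (\<phi> ` U)" "homeomorphism U (\<phi> ` U) \<phi> (inv_into U \<phi>)"
    using assms lie_group by (auto simp: lie_group_def smooth_atlas_def)
  then show "open (Exp -` U)" using continuous_Exp by (simp add: open_vimage)
  show "smooth_on (Exp -` U) (\<lambda>v. \<phi> (Exp v))" "smooth_on (\<phi> ` U) (\<lambda>a. Log (inv_into U \<phi> a))"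
    using assms diffeomorphism by (auto simp: global_diffeomorphism_def smooth_fun_def o_def)
qed

lemma chart_inverse: "(U, \<phi>) \<in> \<A> \<Longrightarrow> x \<in> U \<Longrightarrow> inv_into U \<phi> (\<phi> x) = x"
  using atlas(3) by (auto simp: homeomorphism_def)

lemma atlas_cover: obtains U \<phi> where "(U, \<phi>) \<in> \<A>" "x \<in> U"
proof -
  have "x \<in> (\<Union>(U, \<phi>)\<in>\<A>. U)" using lie_group by (simp add: lie_group_def smooth_atlas_def)
  then show ?thesis using that by auto
qed

lemma continuous_Log: "continuous_on UNIV Log"
proof (rule continuous_at_imp_continuous_on, rule ballI)
  fix x :: 'g
  obtain U \<phi> where U: "(U, \<phi>) \<in> \<A>" "x \<in> U" by (rule atlas_cover)
  have "continuous_on U (\<lambda>y. Log (inv_into U \<phi> (\<phi> y)))"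
    by (rule continuous_on_compose2[OF smooth_on_continuous_on[OF atlas(5)[OF U(1)]]])
       (use atlas(3)[OF U(1)] in \<open>auto simp: homeomorphism_def\<close>)
  then have "continuous_on U Log"
    by (rule continuous_on_eq) (simp add: chart_inverse[OF U(1)])
  then show "isCont Log x"
    using U atlas(1) continuous_on_eq_continuous_at by blast
qed

text \<open>Since \<open>Exp\<close> is a diffeomorphism, \<open>Log\<close> acts as one global
  chart, and the atlas can be forgotten from here on.\<close>

lemma smooth_fun_iff: "smooth_fun \<A> f \<longleftrightarrow> smooth_on UNIV (\<lambda>v. f (Exp v))"
proof
  assume f: "smooth_fun \<A> f"
  show "smooth_on UNIV (\<lambda>v. f (Exp v))"
  proof (rule smooth_on_local)
    fix v :: 'e
    obtain U \<phi> where U: "(U, \<phi>) \<in> \<A>" "Exp v \<in> U" by (rule atlas_cover)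
    have "smooth_on (\<phi> ` U) (\<lambda>a. f (inv_into U \<phi> a))"
      using f U by (auto simp: smooth_fun_def o_def)
    from smooth_on_compose[OF this atlas(4,6)[OF U(1)]]
    have "smooth_on (Exp -` U) (\<lambda>v. f (inv_into U \<phi> (\<phi> (Exp v))))" by auto
    then have "smooth_on (Exp -` U) (\<lambda>v. f (Exp v))"
      by (rule smooth_on_cong[OF atlas(6)[OF U(1)], rotated]) (simp add: chart_inverse[OF U(1)])
    then show "\<exists>W. open W \<and> v \<in> W \<and> smooth_on W (\<lambda>v. f (Exp v))"
      using atlas(6)[OF U(1)] U(2) by auto
  qed
next
  assume f: "smooth_on UNIV (\<lambda>v. f (Exp v))"
  have "smooth_on (\<phi> ` U) (f \<circ> inv_into U \<phi>)" if U: "(U, \<phi>) \<in> \<A>" for U \<phi>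
    using smooth_on_compose[OF f atlas(5,2)[OF U]] by (simp add: o_def)
  then show "smooth_fun \<A> f" by (auto simp: smooth_fun_def)
qed

section \<open>Group law and Lie bracket in the coordinate \<open>Log\<close>\<close>

definition log_mult :: "'e \<Rightarrow> 'e \<Rightarrow> 'e" where
  "log_mult a b = Log (Exp a + Exp b)"

lemma smooth_log_mult: "smooth_on UNIV (\<lambda>(a, b). log_mult a b)"
proof (rule smooth_on_local)
  fix z :: "'e \<times> 'e"
  obtain U \<phi> where U: "(U, \<phi>) \<in> \<A>" "Exp (fst z) \<in> U" by (rule atlas_cover)
  obtain V \<psi> where V: "(V, \<psi>) \<in> \<A>" "Exp (snd z) \<in> V" by (rule atlas_cover)
  obtain W \<xi> where W: "(W, \<xi>) \<in> \<A>" "Exp (fst z) + Exp (snd z) \<in> W" by (rule atlas_cover)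
  \<comment> \<open>The pairs for which the chosen charts contain both factors and the product: an
    open neighbourhood of \<open>z\<close> on which the Lie group axiom applies.\<close>
  define D where "D = {z. Exp (fst z) \<in> U \<and> Exp (snd z) \<in> V \<and> Exp (fst z) + Exp (snd z) \<in> W}"
  have cont: "continuous_on UNIV (\<lambda>z::'e \<times> 'e. Exp (fst z))" "continuous_on UNIV (\<lambda>z::'e \<times> 'e. Exp (snd z))"
    by (auto intro!: continuous_on_compose2[OF continuous_Exp] continuous_intros)
  have "D = (\<lambda>z. Exp (fst z)) -` U \<inter> (\<lambda>z. Exp (snd z)) -` V \<inter> (\<lambda>z. Exp (fst z) + Exp (snd z)) -` W"
    by (auto simp: D_def)
  then have D: "open D"
    using atlas(1)[OF U(1)] atlas(1)[OF V(1)] atlas(1)[OF W(1)] cont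
    by (auto intro!: open_Int open_vimage continuous_on_add)
  let ?E = "{(a, b) \<in> \<phi> ` U \<times> \<psi> ` V. inv_into U \<phi> a + inv_into V \<psi> b \<in> W}"
  have "smooth_on ?E (\<lambda>(a, b). \<xi> (inv_into U \<phi> a + inv_into V \<psi> b))"
    using lie_group U(1) V(1) W(1) unfolding lie_group_def by blast
  moreover have "smooth_on D (\<lambda>z. (\<phi> (Exp (fst z)), \<psi> (Exp (snd z))))"
  proof (rule smooth_on_Pair[OF D])
    show "smooth_on D (\<lambda>z. \<phi> (Exp (fst z)))"
      by (rule smooth_on_compose[OF atlas(4)[OF U(1)] smooth_on_bounded_linear[OF bounded_linear_fst] D])
         (auto simp: D_def)
    show "smooth_on D (\<lambda>z. \<psi> (Exp (snd z)))"
      by (rule smooth_on_compose[OF atlas(4)[OF V(1)] smooth_on_bounded_linear[OF bounded_linear_snd] D])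
         (auto simp: D_def)
  qed
  ultimately have "smooth_on D (\<lambda>z. (\<lambda>(a, b). \<xi> (inv_into U \<phi> a + inv_into V \<psi> b)) (\<phi> (Exp (fst z)), \<psi> (Exp (snd z))))"
    by (rule smooth_on_compose[OF _ _ D]) (auto simp: D_def chart_inverse[OF U(1)] chart_inverse[OF V(1)])
  then have "smooth_on D (\<lambda>z. \<xi> (Exp (fst z) + Exp (snd z)))"
    by (rule smooth_on_cong[OF D, rotated])
       (auto simp: D_def chart_inverse[OF U(1)] chart_inverse[OF V(1)])
  from smooth_on_compose[OF atlas(5)[OF W(1)] this D]
  have "smooth_on D (\<lambda>z. Log (inv_into W \<xi> (\<xi> (Exp (fst z) + Exp (snd z)))))"
    by (auto simp: D_def)
  then have "smooth_on D (\<lambda>(a, b). log_mult a b)"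
    by (rule smooth_on_cong[OF D, rotated])
       (auto simp: D_def log_mult_def chart_inverse[OF W(1)])
  moreover have "z \<in> D" using U V W by (simp add: D_def)
  ultimately show "\<exists>D. open D \<and> z \<in> D \<and> smooth_on D (\<lambda>(a, b). log_mult a b)"
    using D by blast
qed

sublocale exponential_coordinates log_mult
proof
  show "smooth_on UNIV (\<lambda>(a, b). log_mult a b)" by (rule smooth_log_mult)
  show "log_mult (s *\<^sub>R v) (t *\<^sub>R v) = (s + t) *\<^sub>R v" for s t v
    by (simp add: log_mult_def Exp_add[symmetric])
qed (simp_all add: log_mult_def add.assoc)

text \<open>A vector stands for a velocity in the chart \<open>c\<close>, but is used as a vector in
  the coordinate \<open>Log\<close>. The readings agree because \<open>Exp\<close> is normalised in
  \<open>c\<close>: as \<open>Log\<close> sends \<open>Exp (t *\<^sub>R v)\<close> to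
  \<open>t *\<^sub>R v\<close>, the derivative \<open>P\<close> of the transition at the identity
  fixes every vector.\<close>

lemma tangent_curve_has_vector_derivative:
  "((\<lambda>t. Log (tangent_curve c v t)) has_vector_derivative v) (at 0)" "tangent_curve c v 0 = 0"
proof -
  obtain U \<phi> where c: "c = (U, \<phi>)" by (cases c)
  have U: "(U, \<phi>) \<in> \<A>" "0 \<in> U" using chart_at_identity by (auto simp: c)
  show "tangent_curve c v 0 = 0"
    by (simp add: tangent_curve_def c chart_inverse[OF U])
  define P where "P = frechet_derivative (\<lambda>a. Log (inv_into U \<phi> a)) (at (\<phi> 0))"
  have P: "((\<lambda>a. Log (inv_into U \<phi> a)) has_derivative P) (at (\<phi> 0))"
    unfolding P_def using smooth_on_has_derivative[OF atlas(5)[OF U(1)]] U(2) by blast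
  have v: "((\<lambda>t. \<phi> (Exp (t *\<^sub>R v))) has_derivative (\<lambda>t. t *\<^sub>R v)) (at 0)"
    using exponential by (simp add: exponential_map_def c has_vector_derivative_def)
  have "((\<lambda>t. Log (inv_into U \<phi> (\<phi> (Exp (t *\<^sub>R v))))) has_derivative (\<lambda>t. P (t *\<^sub>R v))) (at 0)"
    using has_derivative_compose[OF v, of "\<lambda>a. Log (inv_into U \<phi> a)"] P by simp
  moreover have "open ((\<lambda>t::real. Exp (t *\<^sub>R v)) -` U)"
    by (intro open_vimage atlas(1)[OF U(1)] continuous_on_compose2[OF continuous_Exp] continuous_intros) auto
  ultimately have "((\<lambda>t. t *\<^sub>R v) has_derivative (\<lambda>t. P (t *\<^sub>R v))) (at 0)"
    by (rule has_derivative_transform_within_open) (use U in \<open>auto simp: chart_inverse[OF U(1)]\<close>)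
  moreover have "((\<lambda>t. t *\<^sub>R v) has_derivative (\<lambda>t. t *\<^sub>R v)) (at 0)"
    by (auto intro!: derivative_eq_intros)
  ultimately have "(\<lambda>t. P (t *\<^sub>R v)) = (\<lambda>t. t *\<^sub>R v)" by (rule has_derivative_unique)
  moreover have "((\<lambda>t. \<phi> 0 + t *\<^sub>R v) has_derivative (\<lambda>t. t *\<^sub>R v)) (at 0)"
    by (auto intro!: derivative_eq_intros)
  from has_derivative_compose[OF this, of "\<lambda>a. Log (inv_into U \<phi> a)" P] P
  have "((\<lambda>t. Log (inv_into U \<phi> (\<phi> 0 + t *\<^sub>R v))) has_derivative (\<lambda>t. P (t *\<^sub>R v))) (at 0)" by simp
  ultimately show "((\<lambda>t. Log (tangent_curve c v t)) has_vector_derivative v) (at 0)"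
    by (simp add: has_vector_derivative_def tangent_curve_def c)
qed

lemma left_inv_field_eq:
  assumes f: "smooth_fun \<A> f"
  shows "left_inv_field c v f x = field v (\<lambda>w. f (Exp w)) (Log x)"
proof -
  let ?F = "\<lambda>w. f (Exp w)" and ?\<gamma> = "\<lambda>t. Log (tangent_curve c v t)" and ?X = "Log x"
  have F: "smooth_on UNIV ?F" using f smooth_fun_iff by blast
  have \<gamma>: "(?\<gamma> has_derivative (\<lambda>t. t *\<^sub>R v)) (at 0)" "?\<gamma> 0 = 0"
    using tangent_curve_has_vector_derivative by (auto simp: has_vector_derivative_def)
  have 1: "((\<lambda>t. log_mult ?X (?\<gamma> t)) has_derivative (\<lambda>t. frame ?X (t *\<^sub>R v))) (at 0)"
    using has_derivative_compose[OF \<gamma>(1), of "log_mult ?X"] frame_has_derivative \<gamma>(2) by simp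
  have "((\<lambda>t. ?F (log_mult ?X (?\<gamma> t))) has_derivative (\<lambda>t. frechet_derivative ?F (at ?X) (frame ?X (t *\<^sub>R v)))) (at 0)"
    using has_derivative_compose[OF 1, of ?F] smooth_on_has_derivative[OF F UNIV_I] \<gamma>(2)
    by (simp add: mult_0_right)
  then have "((\<lambda>t. f (x + tangent_curve c v t)) has_vector_derivative frechet_derivative ?F (at ?X) (frame ?X v)) (at 0)"
    by (simp add: has_vector_derivative_def log_mult_def linear_scale[OF linear_frame]
        linear_scale[OF has_derivative_linear[OF smooth_on_has_derivative[OF F UNIV_I]]])
  then show ?thesis
    unfolding left_inv_field_def field_def by (rule vector_derivative_at)
qed

text \<open>Existence for the definite description is \<open>field_bracket\<close>. Uniqueness
  follows by testing on functions \<open>F (Log x)\<close>, which realise every smooth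
  \<open>F\<close> on the coordinate space.\<close>

lemma lie_bracket_eq: "lie_bracket \<A> c v w = bracket v w"
  unfolding lie_bracket_def
proof (rule the_equality)
  have smooth: "smooth_fun \<A> (left_inv_field c v f)" if "smooth_fun \<A> f" for f v
    using that smooth_field[of "\<lambda>w. f (Exp w)" v] by (simp add: left_inv_field_eq smooth_fun_iff)
  have commutator: "left_inv_field c v (left_inv_field c w f) x - left_inv_field c w (left_inv_field c v f) x
      = field (bracket v w) (\<lambda>w. f (Exp w)) (Log x)" if "smooth_fun \<A> f" for f x
    using that smooth[OF that] by (simp add: left_inv_field_eq field_bracket smooth_fun_iff)
  show "\<forall>f. smooth_fun \<A> f \<longrightarrow> (\<forall>x. left_inv_field c (bracket v w) f x =
      left_inv_field c v (left_inv_field c w f) x - left_inv_field c w (left_inv_field c v f) x)"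
    by (simp add: commutator left_inv_field_eq)
  fix u
  assume u: "\<forall>f. smooth_fun \<A> f \<longrightarrow> (\<forall>x. left_inv_field c u f x =
      left_inv_field c v (left_inv_field c w f) x - left_inv_field c w (left_inv_field c v f) x)"
  show "u = bracket v w"
  proof (rule field_determines_vector)
    fix F :: "'e \<Rightarrow> real"
    assume F: "smooth_on UNIV F"
    then have f: "smooth_fun \<A> (\<lambda>x. F (Log x))" by (simp add: smooth_fun_iff)
    then have "left_inv_field c u (\<lambda>x. F (Log x)) 0 = field (bracket v w) F 0"
      using u commutator[OF f, of 0] by simp
    then show "field u F 0 = field (bracket v w) F 0"
      using f by (simp add: left_inv_field_eq)
  qed
qed

lemma dilation_bracket:
  "r > 0 \<Longrightarrow> dilation A r (bracket v w) = bracket (dilation A r v) (dilation A r w)"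
  using dilation_morphism unfolding lie_algebra_morphism_def lie_bracket_eq by blast

section \<open>Haar measure on the group and its scaling\<close>

lemma measurable_Exp: "Exp \<in> borel_measurable borel"
  by (rule borel_measurable_continuous_onI[OF continuous_Exp])

lemma haar_measure_sigma_finite:
  fixes M :: "'g measure"
  assumes M: "haar_measure M"
  shows "sigma_finite_measure M"
proof
  let ?\<K> = "(\<lambda>n. Exp ` cball 0 (real n)) ` UNIV"
  have c: "compact (Exp ` cball 0 (real n))" for n
    by (intro compact_continuous_image continuous_on_subset[OF continuous_Exp]) auto
  have "\<Union>?\<K> = UNIV"
  proof (intro equalityI subsetI UNIV_I)
    fix x :: 'g
    obtain n where "norm (Log x) \<le> real n" using real_arch_simple by blast
    then have "x \<in> Exp ` cball 0 (real n)" by (metis Exp_Log image_eqI mem_cball_0)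
    then show "x \<in> \<Union>?\<K>" by blast
  qed
  moreover have "space M = UNIV"
    using sets_eq_imp_space_eq[OF haar_measureD(1)[OF M]] by simp
  moreover have "?\<K> \<subseteq> sets M"
    using c haar_measureD(1)[OF M] by (auto intro: borel_compact)
  moreover have "\<forall>a\<in>?\<K>. emeasure M a \<noteq> \<infinity>"
    using c haar_measureD(3)[OF M] by (auto simp: less_top[symmetric] dest!: spec)
  ultimately show "\<exists>A. countable A \<and> A \<subseteq> sets M \<and> \<Union>A = space M \<and> (\<forall>a\<in>A. emeasure M a \<noteq> \<infinity>)"
    by (intro exI[of _ ?\<K>]) auto
qed

lemma haar_measure_haar_coords: "haar_measure (distr haar_coords borel Exp)"
  unfolding haar_measure_def
proof (intro conjI allI impI)
  have Exp [measurable]: "Exp \<in> measurable haar_coords borel"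
    using measurable_Exp by (simp cong: measurable_cong_sets)
  show "sets (distr haar_coords borel Exp) = sets borel" by simp
  fix a :: 'g
  have mult: "log_mult (Log a) \<in> measurable haar_coords borel"
    using borel_measurable_continuous_onI[OF smooth_on_continuous_on[OF smooth_translation]]
    by (simp cong: measurable_cong_sets)
  have "distr (distr haar_coords borel Exp) borel (\<lambda>x. a + x) = distr haar_coords borel (\<lambda>v. a + Exp v)"
    by (simp add: distr_distr borel_measurable_translation Exp o_def)
  \<comment> \<open>\<open>Exp\<close> intertwines \<open>log_mult (Log a)\<close> with left
    translation by \<open>a\<close>, so invariance is inherited from the coordinate measure.\<close>
  also have "\<dots> = distr haar_coords borel (Exp \<circ> log_mult (Log a))"
    by (simp add: o_def log_mult_def)
  also have "\<dots> = distr (distr haar_coords borel (log_mult (Log a))) borel Exp"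
    using mult measurable_Exp by (simp add: distr_distr)
  finally show "distr (distr haar_coords borel Exp) borel (\<lambda>x. a + x) = distr haar_coords borel Exp"
    by (simp add: haar_coords_left_invariant)
next
  have Exp: "Exp \<in> measurable haar_coords borel"
    using measurable_Exp by (simp cong: measurable_cong_sets)
  have space: "space haar_coords = UNIV" by (simp add: haar_coords_def)
  fix K :: "'g set" assume K: "compact K"
  have "Exp -` K = Log ` K" by (force simp: image_iff)
  then have "compact (Exp -` K)"
    using compact_continuous_image[OF continuous_on_subset[OF continuous_Log] K] by simp
  then show "emeasure (distr haar_coords borel Exp) K < \<infinity>"
    using Exp K emeasure_haar_coords_compact by (simp add: emeasure_distr space borel_compact)
next
  have Exp: "Exp \<in> measurable haar_coords borel"
    using measurable_Exp by (simp cong: measurable_cong_sets)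
  have space: "space haar_coords = UNIV" by (simp add: haar_coords_def)
  fix U :: "'g set" assume U: "open U \<and> U \<noteq> {}"
  then obtain x where "x \<in> U" by blast
  then have "Log x \<in> Exp -` U" by simp
  then have "Exp -` U \<noteq> {}" by blast
  moreover have "open (Exp -` U)" using U continuous_Exp by (simp add: open_vimage)
  ultimately show "0 < emeasure (distr haar_coords borel Exp) U"
    using Exp U emeasure_haar_coords_open[of "Exp -` U"] by (auto simp: emeasure_distr space)
qed

lemma group_dilation_Exp: "group_dilation Exp A r (Exp v) = Exp (dilation A r v)"
  by (simp add: group_dilation_def)

text \<open>For the image of \<open>haar_coords\<close> the law comes from the determinant of the
  dilation. Uniqueness, used for \<open>F\<close> and for \<open>F\<close> after dilation, carries
  it to \<open>M\<close> with the same factor on both sides.\<close>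

lemma haar_measure_dilation:
  fixes M :: "'g measure"
  assumes M: "haar_measure M" and F: "F \<in> borel_measurable borel" and r: "r > 0"
  shows "(\<integral>\<^sup>+x. F x \<partial>M) = ennreal (r powr homogeneous_dimension A) * (\<integral>\<^sup>+x. F (group_dilation Exp A r x) \<partial>M)"
proof -
  obtain S \<mu> where "eigenframe A S \<mu>" using diagonalisable_eigenframe[OF diagonalisable] .
  then interpret eigenframe A S \<mu> .
  let ?\<nu> = "distr haar_coords borel Exp" and ?V = "Exp ` ball 0 1" and ?c = "ennreal (r powr homogeneous_dimension A)"
  have \<nu>: "haar_measure ?\<nu>" "sigma_finite_measure ?\<nu>"
    using haar_measure_haar_coords haar_measure_sigma_finite by auto
  have "?V = Log -` ball 0 1" by (force simp: image_iff simp del: mem_ball mem_ball_0)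
  then have V: "open ?V" using continuous_Log by (simp add: open_vimage)
  have C: "compact (Exp ` cball 0 1)"
    by (intro compact_continuous_image continuous_on_subset[OF continuous_Exp]) auto
  have VC: "?V \<noteq> {}" "?V \<subseteq> Exp ` cball 0 1" by auto
  have \<delta>: "(\<lambda>x. group_dilation Exp A r x) \<in> borel_measurable borel"
  proof (rule borel_measurable_continuous_onI)
    have "continuous_on UNIV (dilation A r)"
      using linear_dilation linear_continuous_on linear_conv_bounded_linear by blast
    from continuous_on_compose2[OF this continuous_Log]
    have "continuous_on UNIV (\<lambda>x. dilation A r (Log x))" by simp
    from continuous_on_compose2[OF continuous_Exp this]
    show "continuous_on UNIV (\<lambda>x. group_dilation Exp A r x)"
      by (simp add: group_dilation_def)
  qed
  have F\<delta>: "(\<lambda>x. F (group_dilation Exp A r x)) \<in> borel_measurable borel"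
    using measurable_compose[OF \<delta> F] .
  have int: "(\<integral>\<^sup>+x. G x \<partial>?\<nu>) = (\<integral>\<^sup>+v. G (Exp v) \<partial>haar_coords)" if "G \<in> borel_measurable borel" for G
    using that measurable_Exp by (subst nn_integral_distr) (auto cong: measurable_cong_sets)
  have "(\<integral>\<^sup>+x. F x \<partial>?\<nu>) = ?c * (\<integral>\<^sup>+x. F (group_dilation Exp A r x) \<partial>?\<nu>)"
    unfolding int[OF F] int[OF F\<delta>] group_dilation_Exp
    using haar_coords_morphism[OF linear_dilation bij_dilation[OF r] dilation_bracket[OF r],
        of "\<lambda>v. F (Exp v)"] measurable_compose[OF measurable_Exp F]
    by (simp add: linear_det_dilation[OF r] homogeneous_dimension_def)
  then have "(\<integral>\<^sup>+x. F x \<partial>M) * emeasure ?\<nu> ?V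
      = (?c * (\<integral>\<^sup>+x. F (group_dilation Exp A r x) \<partial>M)) * emeasure ?\<nu> ?V"
    using haar_measure_unique[OF M haar_measure_sigma_finite[OF M] \<nu> V VC C F]
      haar_measure_unique[OF M haar_measure_sigma_finite[OF M] \<nu> V VC C F\<delta>]
    by (simp add: ac_simps)
  \<comment> \<open>Being open, non-empty and inside a compact set, \<open>?V\<close> has positive
    finite measure and can be cancelled.\<close>
  moreover have "emeasure ?\<nu> ?V \<noteq> 0"
    using haar_measureD(4)[OF \<nu>(1) V VC(1)] by simp
  moreover have "emeasure ?\<nu> ?V \<le> emeasure ?\<nu> (Exp ` cball 0 1)"
    using VC C by (intro emeasure_mono) (auto intro: borel_compact)
  then have "emeasure ?\<nu> ?V \<noteq> \<infinity>"
    using haar_measureD(3)[OF \<nu>(1) C] by (auto simp: less_top[symmetric] top_unique)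
  ultimately show ?thesis by (metis mult_divide_eq_ennreal infinity_ennreal_def)
qed

end

subsection \<open>Inequalities\<close>

text \<open>Convexity: the graph of \<open>t powr p\<close> lies above its tangent at
  \<open>u\<close>. This is Young's inequality for \<open>u powr (p - 1) * w\<close> with the
  conjugate exponent \<open>p / (p - 1)\<close>, and \<open>u = 0\<close> is included.\<close>

lemma powr_diff_le_tangent:
  fixes u w p :: real
  assumes "p > 1" "u \<ge> 0" "w \<ge> 0"
  shows "u powr p - w powr p \<le> p * (u powr (p - 1) * (u - w))"
proof -
  define q where "q = p / (p - 1)"
  have q: "q > 1" "1 / q + 1 / p = 1" "(p - 1) * q = p"
    using assms(1) by (auto simp: q_def field_simps)
  have "u powr (p - 1) * w \<le> (u powr (p - 1)) powr q / q + w powr p / p"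
    using q assms by (intro Youngs_inequality) auto
  also have "(u powr (p - 1)) powr q / q = u powr p * (1 / q)"
    using q by (simp add: powr_powr)
  also have "1 / q = 1 - 1 / p" using q by simp
  finally have "p * (u powr (p - 1) * w) \<le> p * (u powr p * (1 - 1 / p) + w powr p / p)"
    using assms by (intro mult_left_mono) auto
  also have "\<dots> = p * u powr p - u powr p + w powr p" using assms by (simp add: field_simps)
  also have "u powr p = u powr (p - 1) * u"
    using assms by (cases "u = 0") (auto simp: powr_mult_base[symmetric] mult.commute powr_diff)
  finally show ?thesis
    using \<open>u powr p = u powr (p - 1) * u\<close> by (simp add: algebra_simps)
qed

text \<open>Young's inequality for both factors divided by their norms, then integrated. A vanishing
  norm is treated apart because it forces the product to vanish almost everywhere.\<close>

lemma Hoelder_inequality: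
  fixes u v :: "'a \<Rightarrow> real"
  assumes pq: "p > 1" "q > 1" "1 / p + 1 / q = 1"
    and nonneg: "\<And>x. u x \<ge> 0" "\<And>x. v x \<ge> 0"
    and meas [measurable]: "u \<in> borel_measurable M" "v \<in> borel_measurable M"
    and int: "integrable M (\<lambda>x. u x powr p)" "integrable M (\<lambda>x. v x powr q)"
  shows "(\<integral>x. u x * v x \<partial>M) \<le> (\<integral>x. u x powr p \<partial>M) powr (1 / p) * (\<integral>x. v x powr q \<partial>M) powr (1 / q)"
proof -
  let ?U = "\<integral>x. u x powr p \<partial>M" and ?V = "\<integral>x. v x powr q \<partial>M"
  have zero: "(\<integral>x. u x * v x \<partial>M) = 0" if "?U = 0 \<or> ?V = 0"
  proof -
    have "AE x in M. u x * v x = 0"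
      using that
    proof
      assume "?U = 0"
      then have "AE x in M. u x powr p = 0"
        using integral_nonneg_eq_0_iff_AE[OF int(1)] by simp
      then show ?thesis by eventually_elim simp
    next
      assume "?V = 0"
      then have "AE x in M. v x powr q = 0"
        using integral_nonneg_eq_0_iff_AE[OF int(2)] by simp
      then show ?thesis by eventually_elim simp
    qed
    then have "(\<integral>x. u x * v x \<partial>M) = (\<integral>x. 0 \<partial>M)" by (intro integral_cong_AE) auto
    then show ?thesis by simp
  qed
  show ?thesis
  proof (cases "?U = 0 \<or> ?V = 0")
    case True
    then show ?thesis using zero by simp
  next
    case False
    then have UV: "?U > 0" "?V > 0" by (auto simp: order_less_le)
    define \<alpha> where "\<alpha> = ?U powr (1 / p)"
    define \<beta> where "\<beta> = ?V powr (1 / q)"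
    have ab: "\<alpha> > 0" "\<beta> > 0" "\<alpha> powr p = ?U" "\<beta> powr q = ?V"
      using UV pq by (auto simp: \<alpha>_def \<beta>_def powr_powr)
    have le: "u x * v x / (\<alpha> * \<beta>) \<le> u x powr p / (?U * p) + v x powr q / (?V * q)" for x
      using Youngs_inequality[OF pq, of "u x / \<alpha>" "v x / \<beta>"] nonneg ab
      by (simp add: powr_divide)
    have "(\<integral>x. u x * v x / (\<alpha> * \<beta>) \<partial>M) \<le> (\<integral>x. u x powr p / (?U * p) + v x powr q / (?V * q) \<partial>M)"
      using le int UV pq
      by (intro integral_mono') (auto intro!: integrable_add add_nonneg_nonneg divide_nonneg_pos mult_pos_pos)
    also have "\<dots> = 1 / p + 1 / q"
      using int UV by simp
    finally show ?thesis
      using ab pq unfolding \<alpha>_def[symmetric] \<beta>_def[symmetric] by (simp add: divide_le_eq)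
  qed
qed

lemma has_vector_derivative_quotient_tendsto:
  fixes g :: "real \<Rightarrow> 'a::real_normed_vector"
  assumes "(g has_vector_derivative D) (at x)"
  shows "((\<lambda>h. (1 / h) *\<^sub>R (g (x + h) - g x)) \<longlongrightarrow> D) (at 0)"
proof -
  have "((\<lambda>h. norm (g (x + h) - g x - h *\<^sub>R D) / norm h) \<longlongrightarrow> 0) (at 0)"
    using assms unfolding has_vector_derivative_def has_derivative_at by blast
  moreover have "\<forall>\<^sub>F h in at 0. norm (g (x + h) - g x - h *\<^sub>R D) / norm h
      = norm ((1 / h) *\<^sub>R (g (x + h) - g x) - D)"
  proof (rule eventually_at_filter[THEN iffD2], rule always_eventually, intro allI impI)
    fix h :: real
    assume h: "h \<noteq> 0"
    have "(1 / h) *\<^sub>R (g (x + h) - g x) - D = (1 / h) *\<^sub>R (g (x + h) - g x - h *\<^sub>R D)"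
      using h by (simp add: scaleR_diff_right)
    then show "norm (g (x + h) - g x - h *\<^sub>R D) / norm h = norm ((1 / h) *\<^sub>R (g (x + h) - g x) - D)"
      by simp
  qed
  ultimately have "((\<lambda>h. norm ((1 / h) *\<^sub>R (g (x + h) - g x) - D)) \<longlongrightarrow> 0) (at 0)"
    by (rule Lim_transform_eventually)
  from LIM_zero_cancel[OF tendsto_norm_zero_cancel[OF this]] show ?thesis .
qed

section \<open>Radial derivative and Hardy inequality on the group\<close>

context homogeneous_group
begin

text \<open>Continuity is required on \<open>K\<close> only: quotients by the quasi-norm are
  continuous on a support that avoids the identity, and outside it they vanish.\<close>

lemma integrable_continuous_on_compact_support:
  fixes h :: "'g \<Rightarrow> real"
  assumes M: "haar_measure M" and K: "compact K" "continuous_on K h" "\<And>x. x \<notin> K \<Longrightarrow> h x = 0"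
  shows "integrable M h" "h \<in> borel_measurable borel"
proof -
  have "(\<lambda>x. indicator K x *\<^sub>R h x) \<in> borel_measurable borel"
    using K by (intro borel_measurable_continuous_on_indicator borel_compact)
  moreover have "(\<lambda>x. indicator K x *\<^sub>R h x) = h"
    using K(3) by (auto simp: fun_eq_iff split: split_indicator)
  ultimately show h: "h \<in> borel_measurable borel" by simp
  have "bounded (h ` K)"
    using compact_continuous_image[OF K(2,1)] by (rule compact_imp_bounded)
  then obtain B where "\<And>x. x \<in> K \<Longrightarrow> norm (h x) \<le> B"
    by (auto simp: bounded_iff)
  then show "integrable M h"
    using h haar_measureD(1)[OF M] haar_measureD(3)[OF M K(1)] K
    by (intro integrableI_bounded_set[of K _ _ B]) (auto simp: borel_compact cong: measurable_cong_sets)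
qed

lemma group_dilation_facts:
  shows "r > 0 \<Longrightarrow> s > 0 \<Longrightarrow> group_dilation Exp A r (group_dilation Exp A s x) = group_dilation Exp A (r * s) x"
    and "group_dilation Exp A 1 x = x"
    and "group_dilation Exp A t 0 = 0"
    and "continuous_on ({0<..} \<times> UNIV) (\<lambda>z. group_dilation Exp A (fst z) (snd z))"
proof -
  obtain S \<mu> where "eigenframe A S \<mu>" using diagonalisable_eigenframe[OF diagonalisable] .
  then interpret eigenframe A S \<mu> .
  show "r > 0 \<Longrightarrow> s > 0 \<Longrightarrow> group_dilation Exp A r (group_dilation Exp A s x) = group_dilation Exp A (r * s) x"
    by (simp add: group_dilation_def dilation_dilation)
  show "group_dilation Exp A 1 x = x" by (simp add: group_dilation_def dilation_one)
  show "group_dilation Exp A t 0 = 0" by (simp add: group_dilation_def linear_0[OF linear_dilation])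
  have "continuous_on UNIV (\<lambda>z::real \<times> 'g. Log (snd z))"
    by (rule continuous_on_compose2[OF continuous_Log continuous_on_snd]) (auto intro: continuous_on_id)
  then have "continuous_on ({0<..} \<times> UNIV) (\<lambda>z::real \<times> 'g. (fst z, Log (snd z)))"
    by (intro continuous_on_Pair continuous_on_fst continuous_on_id) (auto intro: continuous_on_subset)
  moreover have "(\<lambda>z::real \<times> 'g. (fst z, Log (snd z))) ` ({0<..} \<times> UNIV) \<subseteq> {0<..} \<times> UNIV"
    by auto
  ultimately have "continuous_on ({0<..} \<times> UNIV) (\<lambda>z. dilation A (fst z) (Log (snd z)))"
    using continuous_on_compose2[OF continuous_on_dilation] by fastforce
  from continuous_on_compose2[OF continuous_Exp this]
  show "continuous_on ({0<..} \<times> UNIV) (\<lambda>z. group_dilation Exp A (fst z) (snd z))"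
    by (simp add: group_dilation_def)
qed

text \<open>The derivative of \<open>f\<close> along the generator of the dilations, that is, the
  radial derivative times the quasi-norm. It involves no quasi-norm and is continuous at the
  identity as well.\<close>

definition euler_field :: "('g \<Rightarrow> complex) \<Rightarrow> 'g \<Rightarrow> complex" where
  "euler_field f x = frechet_derivative (\<lambda>v. f (Exp v)) (at (Log x)) (A (Log x))"

lemma continuous_euler_field:
  assumes "smooth_fun \<A> f"
  shows "continuous_on UNIV (euler_field f)"
proof -
  have "linear A" using diagonalisable by (simp add: diagonalisable_def)
  then have A: "bounded_linear A" by (simp add: linear_conv_bounded_linear)
  have "continuous_on UNIV (\<lambda>(x, v). frechet_derivative (\<lambda>v. f (Exp v)) (at x) v)"
    using smooth_on_continuous_on[OF smooth_on_frechet_derivative_joint] assms smooth_fun_iff by blast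
  moreover have "continuous_on UNIV (\<lambda>x. (Log x, A (Log x)))"
    by (intro continuous_on_Pair continuous_Log bounded_linear.continuous_on[OF A])
  ultimately have "continuous_on UNIV
      (\<lambda>x. (\<lambda>(x, v). frechet_derivative (\<lambda>v. f (Exp v)) (at x) v) (Log x, A (Log x)))"
    by (rule continuous_on_compose2) auto
  then show ?thesis by (simp add: euler_field_def[abs_def])
qed

lemma dilation_curve_has_vector_derivative:
  assumes f: "smooth_fun \<A> f" and r: "r > 0"
  shows "((\<lambda>r. f (group_dilation Exp A r x)) has_vector_derivative
    (1 / r) *\<^sub>R euler_field f (group_dilation Exp A r x)) (at r)"
proof -
  obtain S \<mu> where "eigenframe A S \<mu>" using diagonalisable_eigenframe[OF diagonalisable] .
  then interpret eigenframe A S \<mu> .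
  let ?F = "\<lambda>v. f (Exp v)" and ?v = "dilation A r (Log x)"
  have F: "(?F has_derivative frechet_derivative ?F (at ?v)) (at ?v)"
    using smooth_on_has_derivative f smooth_fun_iff by blast
  have "((\<lambda>r. ?F (dilation A r (Log x))) has_derivative
      (\<lambda>h. frechet_derivative ?F (at ?v) (h *\<^sub>R (1 / r) *\<^sub>R A ?v))) (at r)"
    by (rule has_derivative_compose[where f = "\<lambda>r. dilation A r (Log x)" and g = ?F, OF _ F])
       (use dilation_has_vector_derivative[OF r] in \<open>simp add: has_vector_derivative_def\<close>)
  then show ?thesis
    by (simp add: has_vector_derivative_def group_dilation_def euler_field_def
        linear_scale[OF has_derivative_linear[OF F]])
qed

lemma euler_field_outside_support:
  assumes "x \<notin> closure {x. f x \<noteq> 0}"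
  shows "euler_field f x = 0"
proof -
  let ?W = "Exp -` (- closure {x. f x \<noteq> 0})"
  have W: "open ?W" "Log x \<in> ?W"
    using assms continuous_Exp by (auto intro!: open_vimage)
  have "((\<lambda>v. 0 :: complex) has_derivative (\<lambda>h. 0)) (at (Log x))" by simp
  then have "((\<lambda>v. f (Exp v)) has_derivative (\<lambda>h. 0)) (at (Log x))"
  proof (rule has_derivative_transform_within_open[OF _ W])
    fix v assume "v \<in> ?W"
    then have "Exp v \<notin> {x. f x \<noteq> 0}" using closure_subset[of "{x. f x \<noteq> 0}"] by auto
    then show "0 = f (Exp v)" by simp
  qed
  then show ?thesis unfolding euler_field_def by (rule frechet_derivative_eqI)
qed

lemma radial_derivative_eq:
  assumes f: "smooth_fun \<A> f" and N: "homogeneous_quasi_norm Exp A N"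
  shows "radial_derivative Exp A N f x = (1 / N x) *\<^sub>R euler_field f x"
proof (cases "x = 0")
  \<comment> \<open>Default values agree: the dilation curve through the identity is constant, so
    the left side is 0, and the right side is 0 because \<open>1 / 0 = 0\<close>.\<close>
  case True
  then show ?thesis
    using N by (simp add: radial_derivative_def group_dilation_facts(3) homogeneous_quasi_norm_def)
next
  case False
  then have Nx: "N x > 0" using N by (simp add: homogeneous_quasi_norm_def order_less_le)
  then have "group_dilation Exp A (N x) (group_dilation Exp A (1 / N x) x) = x"
    by (simp add: group_dilation_facts)
  then show ?thesis
    using vector_derivative_at[OF dilation_curve_has_vector_derivative[OF f Nx, of "group_dilation Exp A (1 / N x) x"]]
    by (simp add: radial_derivative_def Let_def)
qed

text \<open>
  Scaling gives \<open>\<integral>(\<bar>f \<circ> D\<^sub>r\<bar> / N)\<^sup>p = r powr (p - Q) * \<integral>(\<bar>f\<bar> / N)\<^sup>p\<close>; comparing this with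
  the tangent line inequality for \<open>t powr p\<close> and letting \<open>r\<close> tend to \<open>1\<close> avoids differentiating
  \<open>\<bar>f\<bar>\<^sup>p\<close> at the zeros of \<open>f\<close>.
\<close>

lemma hardy_inequality_integrated:
  fixes f :: "'g \<Rightarrow> complex" and p :: real
  assumes f: "f \<in> test_functions_off_zero \<A>" and N: "homogeneous_quasi_norm Exp A N"
    and M: "haar_measure M" and p: "1 < p"
  shows "(homogeneous_dimension A - p) * (\<integral>x. (cmod (f x) / N x) powr p \<partial>M)
    \<le> p * (\<integral>x. (cmod (f x) / N x) powr (p - 1) * cmod (radial_derivative Exp A N f x) \<partial>M)"
proof -
  define Q where "Q = homogeneous_dimension A"
  define K where "K = closure {x. f x \<noteq> 0}"
  have smooth: "smooth_fun \<A> f" and K: "compact K" "0 \<notin> K"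
    using f by (auto simp: test_functions_off_zero_def K_def)
  have f0: "f x = 0" if "x \<notin> K" for x using that closure_subset[of "{x. f x \<noteq> 0}"] by (auto simp: K_def)
  have contN: "continuous_on UNIV N" and N0: "\<And>x. N x \<ge> 0" and NK: "\<And>x. x \<in> K \<Longrightarrow> N x > 0"
    using N K(2) unfolding homogeneous_quasi_norm_def by (auto simp: order_less_le)
  have N\<delta>: "N (group_dilation Exp A r x) = r * N x" if "r > 0" for r x
    using N that by (simp add: homogeneous_quasi_norm_def)
  have "continuous_on UNIV (\<lambda>x. f (Exp (Log x)))"
    using continuous_on_compose2[OF smooth_on_continuous_on continuous_Log, of UNIV "\<lambda>v. f (Exp v)"] smooth smooth_fun_iff by blast
  then have contf: "continuous_on UNIV f" by simp
  note cont = continuous_on_subset[OF contf subset_UNIV] continuous_on_subset[OF contN subset_UNIV]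
    continuous_on_subset[OF continuous_euler_field[OF smooth] subset_UNIV]
  have sM [measurable_cong]: "sets M = sets borel" using haar_measureD(1)[OF M] .
  have [measurable]: "f \<in> borel_measurable borel" "N \<in> borel_measurable borel" "euler_field f \<in> borel_measurable borel"
    using contf contN continuous_euler_field[OF smooth] borel_measurable_continuous_onI by auto
  have \<delta>: "(\<lambda>x. group_dilation Exp A r x) \<in> borel_measurable borel" if "r > 0" for r
  proof (rule borel_measurable_continuous_onI)
    have "continuous_on UNIV (\<lambda>x::'g. (r, x))" by (intro continuous_intros)
    from continuous_on_compose2[OF group_dilation_facts(4) this] that
    show "continuous_on UNIV (\<lambda>x. group_dilation Exp A r x)" by auto
  qed
  let ?a = "\<lambda>x. cmod (f x) / N x"
  define G where "G = (\<integral>x. ?a x powr p \<partial>M)"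
  \<comment> \<open>Keeps \<open>1 + h n\<close> in the compact interval from 1 to 2, on which the
    difference quotients admit a uniform bound.\<close>
  define h where "h n = 1 / real (Suc n)" for n
  have h: "h n > 0" "h n \<le> 1" for n by (auto simp: h_def)
  have h_lim: "filterlim h (at 0) sequentially"
    unfolding filterlim_at using h LIMSEQ_inverse_real_of_nat
    by (auto simp: h_def[abs_def] divide_inverse intro!: always_eventually)
  define \<Delta> where "\<Delta> n x = (1 / h n) *\<^sub>R (f (group_dilation Exp A (1 + h n) x) - f x)" for n x
  have contp: "continuous_on K (\<lambda>x. ?a x powr e)" if "e > 0" for e
    using NK that by (intro continuous_on_powr' continuous_intros cont) (auto simp: less_imp_le less_imp_neq[symmetric])
  have int_ap: "integrable M (\<lambda>x. ?a x powr p)"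
    using p f0 by (intro integrable_continuous_on_compact_support(1)[OF M K(1)] contp) auto
  have scaled: "(\<integral>x. (cmod (f (group_dilation Exp A r x)) / N x) powr p \<partial>M) = r powr (p - Q) * G"
    and scaled_integrable: "integrable M (\<lambda>x. (cmod (f (group_dilation Exp A r x)) / N x) powr p)" if r: "r > 0" for r
  proof -
    let ?I = "\<integral>\<^sup>+x. ennreal (?a (group_dilation Exp A r x) powr p) \<partial>M"
    have m [measurable]: "(\<lambda>x. ?a x powr p) \<in> borel_measurable borel" by measurable
    have m' [measurable]: "(\<lambda>x. ?a (group_dilation Exp A r x) powr p) \<in> borel_measurable M"
      using measurable_compose[OF \<delta>[OF r] m] by (simp cong: measurable_cong_sets add: sM)
    have I: "(\<integral>\<^sup>+x. ennreal (?a x powr p) \<partial>M) = ennreal (r powr Q) * ?I"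
      unfolding Q_def by (rule haar_measure_dilation[OF M _ r]) measurable
    have G: "(\<integral>\<^sup>+x. ennreal (?a x powr p) \<partial>M) = ennreal G"
      unfolding G_def by (intro nn_integral_eq_integral int_ap) auto
    \<comment> \<open>Finiteness is read off the scaling law: an infinite \<open>?I\<close>,
      multiplied by the positive \<open>r powr Q\<close>, could not equal the finite
      \<open>G\<close>.\<close>
    have "?I < \<infinity>"
    proof (rule ccontr)
      assume "\<not> ?I < \<infinity>"
      then have "?I = top" by (simp add: less_top[symmetric])
      then have "ennreal G = top" using I[unfolded G] r by (simp add: ennreal_mult_top)
      then show False by simp
    qed
    then have int: "integrable M (\<lambda>x. ?a (group_dilation Exp A r x) powr p)"
      by (intro integrableI_nonneg m') auto
    \<comment> \<open>Homogeneity of \<open>N\<close> contributes the power \<open>- p\<close> of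
      \<open>r\<close>, against the power \<open>Q\<close> contributed by Haar measure.\<close>
    have eq: "?a (group_dilation Exp A r x) powr p = r powr (- p) * (cmod (f (group_dilation Exp A r x)) / N x) powr p" for x
    proof -
      have "?a (group_dilation Exp A r x) = (cmod (f (group_dilation Exp A r x)) / N x) / r"
        using r by (simp add: N\<delta>)
      also have "\<dots> powr p = (cmod (f (group_dilation Exp A r x)) / N x) powr p / r powr p"
        by (rule powr_divide)
      finally show ?thesis by (simp only: powr_minus divide_inverse mult.commute)
    qed
    then have eq': "(cmod (f (group_dilation Exp A r x)) / N x) powr p = r powr p * ?a (group_dilation Exp A r x) powr p" for x
      using r by (simp add: powr_minus)
    show "integrable M (\<lambda>x. (cmod (f (group_dilation Exp A r x)) / N x) powr p)"
      unfolding eq' using int by simp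
    have "ennreal G = ennreal (r powr Q * (\<integral>x. ?a (group_dilation Exp A r x) powr p \<partial>M))"
      using I G nn_integral_eq_integral[OF int] by (simp add: ennreal_mult)
    then have "G = r powr Q * (\<integral>x. ?a (group_dilation Exp A r x) powr p \<partial>M)"
      by (subst (asm) ennreal_inj) (auto simp: G_def)
    then show "(\<integral>x. (cmod (f (group_dilation Exp A r x)) / N x) powr p \<partial>M) = r powr (p - Q) * G"
      unfolding eq' using r by (simp add: powr_diff)
  qed
  \<comment> \<open>Prepares dominated convergence: the mean value inequality bounds the quotients
    by the dilation derivative on a compact set. A bound on \<open>K\<close> is enough because the
    weight \<open>w\<close> vanishes elsewhere.\<close>
  have "\<exists>C. \<forall>x\<in>K. \<forall>n. cmod (\<Delta> n x) \<le> C"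
  proof -
    let ?D = "\<lambda>z. (1 / fst z) *\<^sub>R euler_field f (group_dilation Exp A (fst z) (snd z))"
    have "continuous_on ({1..2} \<times> K) ?D"
      by (intro continuous_intros continuous_on_compose2[OF continuous_euler_field[OF smooth]]
          continuous_on_subset[OF group_dilation_facts(4)]) auto
    then have "bounded (?D ` ({1..2} \<times> K))"
      using K by (intro compact_imp_bounded compact_continuous_image compact_Times) auto
    then obtain C where C: "\<And>s x. s \<in> {1..2} \<Longrightarrow> x \<in> K \<Longrightarrow> cmod (?D (s, x)) \<le> C"
      by (force simp: bounded_iff)
    have "cmod (\<Delta> n x) \<le> C" if x: "x \<in> K" for n x
    proof -
      have "cmod (f (group_dilation Exp A (1 + h n) x) - f (group_dilation Exp A 1 x)) \<le> C * norm (1 + h n - 1)"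
      proof (rule differentiable_bound[of "{1..2}"])
        show "((\<lambda>s. f (group_dilation Exp A s x)) has_derivative (\<lambda>t. t *\<^sub>R ?D (s, x))) (at s within {1..2})"
          if "s \<in> {1..2}" for s
          using dilation_curve_has_vector_derivative[OF smooth, of s x] that
          unfolding has_vector_derivative_def by (auto intro: has_derivative_at_withinI)
        show "onorm (\<lambda>t. t *\<^sub>R ?D (s, x)) \<le> C" if "s \<in> {1..2}" for s
        proof (rule onorm_le)
          fix t :: real
          have "norm (t *\<^sub>R ?D (s, x)) = cmod (?D (s, x)) * norm t" by (simp only: norm_scaleR real_norm_def mult.commute)
          also have "\<dots> \<le> C * norm t" using C[OF that x] by (rule mult_right_mono) simp
          finally show "norm (t *\<^sub>R ?D (s, x)) \<le> C * norm t" .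
        qed
      qed (use h[of n] in auto)
      then show ?thesis using h[of n]
        by (simp add: \<Delta>_def group_dilation_facts(2) pos_divide_le_eq)
    qed
    then show ?thesis by blast
  qed
  then obtain C where C: "\<And>x n. x \<in> K \<Longrightarrow> cmod (\<Delta> n x) \<le> C" by blast
  have \<Delta>_lim: "(\<lambda>n. \<Delta> n x) \<longlonglongrightarrow> euler_field f x" for x
    using filterlim_compose[OF has_vector_derivative_quotient_tendsto[OF dilation_curve_has_vector_derivative[OF smooth, of 1 x]] h_lim]
    by (simp add: \<Delta>_def group_dilation_facts(2))
  \<comment> \<open>The slope of the tangent inequality without its factor \<open>p\<close>, divided
    by the quasi-norm; off \<open>K\<close> it vanishes because
    \<open>0 powr (p - 1) = 0\<close>.\<close>
  define w where "w x = ?a x powr (p - 1) / N x" for x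
  have w0: "w x \<ge> 0" for x using N0 by (simp add: w_def)
  have wK: "w x = 0" if "x \<notin> K" for x using f0[OF that] by (simp add: w_def)
  have [measurable]: "w \<in> borel_measurable borel" unfolding w_def[abs_def] by measurable
  have [measurable]: "\<Delta> n \<in> borel_measurable borel" for n
    unfolding \<Delta>_def[abs_def] using measurable_compose[OF \<delta>, of "1 + h n" f] h[of n] by simp
  have int_w: "integrable M (\<lambda>x. C * w x)"
    using p NK wK unfolding w_def
    by (intro integrable_continuous_on_compact_support(1)[OF M K(1)] continuous_intros contp cont) force+
  have bound: "norm (w x * cmod (\<Delta> n x)) \<le> C * w x" for n x
    using mult_left_mono[OF C[of x n] w0[of x]] w0[of x] wK[of x]
    by (cases "x \<in> K") (auto simp: mult.commute)
  have int_w\<Delta>: "integrable M (\<lambda>x. w x * cmod (\<Delta> n x))" for n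
    by (rule Bochner_Integration.integrable_bound[OF int_w]) (use order_trans[OF bound abs_ge_self] in auto)
  have lim_right: "(\<lambda>n. \<integral>x. w x * cmod (\<Delta> n x) \<partial>M) \<longlonglongrightarrow> (\<integral>x. w x * cmod (euler_field f x) \<partial>M)"
    by (rule integral_dominated_convergence[OF _ _ int_w])
       (use bound in \<open>auto intro!: tendsto_intros \<Delta>_lim\<close>)
  have le: "(1 - (1 + h n) powr (p - Q)) / h n * G \<le> p * (\<integral>x. w x * cmod (\<Delta> n x) \<partial>M)" for n
  proof -
    let ?r = "1 + h n"
    let ?b = "\<lambda>x. cmod (f (group_dilation Exp A ?r x)) / N x"
    have r: "?r > 0" using h[of n] by simp
    have "(1 - ?r powr (p - Q)) * G = (\<integral>x. ?a x powr p - ?b x powr p \<partial>M)"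
      using int_ap scaled_integrable[OF r] by (simp add: scaled[OF r] G_def algebra_simps)
    also have "\<dots> \<le> (\<integral>x. (p * h n) * (w x * cmod (\<Delta> n x)) \<partial>M)"
    proof (rule integral_mono)
      fix x
      \<comment> \<open>The tangent is taken at \<open>?a x\<close>, not at the dilated value, so
        the weight does not depend on \<open>n\<close> and is supported in \<open>K\<close>.\<close>
      have "?a x powr p - ?b x powr p \<le> p * (?a x powr (p - 1) * (?a x - ?b x))"
        using p N0 by (intro powr_diff_le_tangent) auto
      also have "\<dots> \<le> p * (?a x powr (p - 1) * (h n * cmod (\<Delta> n x) / N x))"
      proof (intro mult_left_mono)
        have "cmod (f x) - cmod (f (group_dilation Exp A ?r x)) \<le> h n * cmod (\<Delta> n x)"
          using norm_triangle_ineq2[of "f x" "f (group_dilation Exp A ?r x)"] h[of n]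
          by (simp add: \<Delta>_def norm_minus_commute)
        then show "?a x - ?b x \<le> h n * cmod (\<Delta> n x) / N x"
          using N0 by (simp add: diff_divide_distrib[symmetric] divide_right_mono)
      qed (use p in auto)
      finally show "?a x powr p - ?b x powr p \<le> (p * h n) * (w x * cmod (\<Delta> n x))"
        by (simp add: w_def ac_simps)
    qed (use int_ap scaled_integrable[OF r] int_w\<Delta> in auto)
    also have "\<dots> = (p * h n) * (\<integral>x. w x * cmod (\<Delta> n x) \<partial>M)"
      by (rule integral_mult_right_zero)
    finally show ?thesis using h[of n] by (simp add: pos_divide_le_eq ac_simps)
  qed
  have lim_left: "(\<lambda>n. (1 - (1 + h n) powr (p - Q)) / h n * G) \<longlonglongrightarrow> (Q - p) * G"
  proof -
    \<comment> \<open>The origin of the constant \<open>Q - p\<close> in the Hardy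
      inequality.\<close>
    have "((\<lambda>r. 1 - r powr (p - Q)) has_real_derivative (Q - p)) (at 1)"
      by (auto intro!: derivative_eq_intros)
    then have "((\<lambda>k. (1 - (1 + k) powr (p - Q)) / k) \<longlongrightarrow> Q - p) (at 0)"
      by (simp add: DERIV_def)
    from tendsto_mult[OF filterlim_compose[OF this h_lim] tendsto_const[of G]]
    show ?thesis .
  qed
  have "(Q - p) * G \<le> p * (\<integral>x. w x * cmod (euler_field f x) \<partial>M)"
    by (rule LIMSEQ_le[OF lim_left tendsto_mult[OF tendsto_const lim_right]]) (use le in blast)
  also have "(\<lambda>x. w x * cmod (euler_field f x)) = (\<lambda>x. ?a x powr (p - 1) * cmod (radial_derivative Exp A N f x))"
    using N0 by (simp add: fun_eq_iff radial_derivative_eq[OF smooth N] w_def)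
  finally show ?thesis by (simp add: Q_def G_def)
qed

lemma hardy_uncertainty_inequality:
  fixes f :: "'g \<Rightarrow> complex" and p q :: real
  assumes f: "f \<in> test_functions_off_zero \<A>" and N: "homogeneous_quasi_norm Exp A N"
    and M: "haar_measure M" and p: "1 < p" "p < homogeneous_dimension A" and pq: "1 / p + 1 / q = 1"
  shows "(homogeneous_dimension A - p) / p * (\<integral>x. (cmod (f x))\<^sup>2 \<partial>M)
    \<le> (\<integral>x. cmod (radial_derivative Exp A N f x) powr p \<partial>M) powr (1 / p)
      * (\<integral>x. N x powr q * cmod (f x) powr q \<partial>M) powr (1 / q)"
proof -
  define K where "K = closure {x. f x \<noteq> 0}"
  have smooth: "smooth_fun \<A> f" and K: "compact K" "0 \<notin> K"
    using f by (auto simp: test_functions_off_zero_def K_def)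
  have f0: "f x = 0" if "x \<notin> K" for x using that closure_subset[of "{x. f x \<noteq> 0}"] by (auto simp: K_def)
  have e0: "euler_field f x = 0" if "x \<notin> K" for x using that euler_field_outside_support by (simp add: K_def)
  have contN: "continuous_on UNIV N" and N0: "\<And>x. N x \<ge> 0" and NK: "\<And>x. x \<in> K \<Longrightarrow> N x > 0"
    using N K(2) unfolding homogeneous_quasi_norm_def by (auto simp: order_less_le)
  have "continuous_on UNIV (\<lambda>x. f (Exp (Log x)))"
    using continuous_on_compose2[OF smooth_on_continuous_on continuous_Log, of UNIV "\<lambda>v. f (Exp v)"] smooth smooth_fun_iff by blast
  then have contf: "continuous_on UNIV f" by simp
  note cont = continuous_on_subset[OF contf subset_UNIV] continuous_on_subset[OF contN subset_UNIV]
    continuous_on_subset[OF continuous_euler_field[OF smooth] subset_UNIV]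
  have sM [measurable_cong]: "sets M = sets borel" using haar_measureD(1)[OF M] .
  have "1 / q = (p - 1) / p" using pq p(1) by (simp add: diff_divide_distrib)
  then have q: "q = p / (p - 1)" by (metis inverse_divide inverse_eq_divide div_by_1 divide_divide_eq_right mult_1)
  then have "q > 1" using p(1) by simp
  note q = q this
  \<comment> \<open>With this relation Hoelder's inequality for \<open>?a powr (p - 1)\<close>
    returns a power of \<open>G\<close> itself.\<close>
  have qp: "(p - 1) * q = p" using q p by simp
  let ?a = "\<lambda>x. cmod (f x) / N x" and ?R = "\<lambda>x. cmod (radial_derivative Exp A N f x)" and ?b = "\<lambda>x. N x * cmod (f x)"
  define G where "G = (\<integral>x. ?a x powr p \<partial>M)"
  define R where "R = (\<integral>x. ?R x powr p \<partial>M) powr (1 / p)"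
  define Y where "Y = (\<integral>x. ?b x powr q \<partial>M) powr (1 / q)"
  have [measurable]: "f \<in> borel_measurable borel" "N \<in> borel_measurable borel" "euler_field f \<in> borel_measurable borel"
    using contf contN continuous_euler_field[OF smooth] borel_measurable_continuous_onI by auto
  have R_eq: "?R x = cmod (euler_field f x) / N x" for x
    using N0 by (simp add: radial_derivative_eq[OF smooth N])
  have [measurable]: "?R \<in> borel_measurable borel"
    unfolding R_eq by measurable
  have int_a: "integrable M (\<lambda>x. ?a x powr p)"
    using p f0 NK
    by (intro integrable_continuous_on_compact_support(1)[OF M K(1)] continuous_on_powr' continuous_intros cont)
       (auto simp: less_imp_le less_imp_neq[symmetric])
  have int_R: "integrable M (\<lambda>x. ?R x powr p)"
    unfolding R_eq using p e0 NK
    by (intro integrable_continuous_on_compact_support(1)[OF M K(1)] continuous_on_powr' continuous_intros cont)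
       (auto simp: less_imp_le less_imp_neq[symmetric])
  have int_b: "integrable M (\<lambda>x. ?b x powr q)"
    using q f0 NK
    by (intro integrable_continuous_on_compact_support(1)[OF M K(1)] continuous_on_powr' continuous_intros cont)
       (auto simp: less_imp_le)
  have "(homogeneous_dimension A - p) * G \<le> p * (\<integral>x. ?a x powr (p - 1) * ?R x \<partial>M)"
    unfolding G_def by (rule hardy_inequality_integrated[OF f N M p(1)])
  also have "(\<integral>x. ?a x powr (p - 1) * ?R x \<partial>M)
      \<le> (\<integral>x. (?a x powr (p - 1)) powr q \<partial>M) powr (1 / q) * R"
    unfolding R_def using q p pq int_a int_R
    by (intro Hoelder_inequality) (auto simp: powr_powr qp add.commute)
  also have "(\<lambda>x. (?a x powr (p - 1)) powr q) = (\<lambda>x. ?a x powr p)"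
    by (simp add: powr_powr qp)
  finally have "(homogeneous_dimension A - p) * G \<le> p * (G powr (1 / q) * R)"
    using p by (simp add: G_def)
  then have 1: "(homogeneous_dimension A - p) / p * G \<le> G powr (1 / q) * R"
    using p by (simp add: pos_divide_le_eq mult.commute)
  \<comment> \<open>Dividing by \<open>G powr (1 / q)\<close> leaves the exponent
    \<open>1 - 1 / q = 1 / p\<close>. For \<open>G = 0\<close> the left side is 0.\<close>
  have hardy: "(homogeneous_dimension A - p) / p * G powr (1 / p) \<le> R"
  proof (cases "G = 0")
    case True
    then show ?thesis by (simp add: R_def)
  next
    case False
    then have G: "G > 0" by (simp add: G_def order_less_le)
    have "G = G powr (1 / q) * G powr (1 / p)"
      using G pq by (simp add: powr_add[symmetric] add.commute)
    then have "G powr (1 / q) * ((homogeneous_dimension A - p) / p * G powr (1 / p)) \<le> G powr (1 / q) * R"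
      using 1 by (metis mult.left_commute)
    then show ?thesis by (rule mult_left_le_imp_le) (use G in simp)
  qed
  \<comment> \<open>The quasi-norm cancels on \<open>K\<close>, where it is positive. Elsewhere,
    including the identity with its division by zero, \<open>f\<close> vanishes.\<close>
  have "(\<integral>x. (cmod (f x))\<^sup>2 \<partial>M) = (\<integral>x. ?a x * ?b x \<partial>M)"
  proof (rule Bochner_Integration.integral_cong[OF refl])
    fix x
    show "(cmod (f x))\<^sup>2 = ?a x * ?b x"
      using f0[of x] NK[of x] by (cases "x \<in> K") (auto simp: power2_eq_square)
  qed
  also have "\<dots> \<le> G powr (1 / p) * Y"
    unfolding G_def Y_def using q p pq int_a int_b N0 by (intro Hoelder_inequality) auto
  \<comment> \<open>The factor is non-negative because \<open>p\<close> is below the homogeneous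
    dimension, so it can be multiplied in before the Hardy inequality absorbs it.\<close>
  finally have "(homogeneous_dimension A - p) / p * (\<integral>x. (cmod (f x))\<^sup>2 \<partial>M)
      \<le> (homogeneous_dimension A - p) / p * (G powr (1 / p) * Y)"
    using p by (intro mult_left_mono) auto
  also have "\<dots> \<le> R * Y"
    using mult_right_mono[OF hardy, of Y] by (simp add: Y_def mult.assoc)
  finally show ?thesis
    using N0 by (simp add: R_def Y_def powr_mult)
qed

end

theorem corollary3p4:
  fixes \<A> :: "('g::{topological_group_add, t2_space, second_countable_topology}, 'e::euclidean_space) chart set"
    and c :: "('g, 'e) chart"
    and Exp :: "'e \<Rightarrow> 'g"
    and A :: "'e \<Rightarrow> 'e"
    and N :: "'g \<Rightarrow> real"
    and M :: "'g measure"
    and f :: "'g \<Rightarrow> complex"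
    and p q Q :: real
  assumes "homogeneous_group \<A> c Exp A"
    and "Q = homogeneous_dimension A" and "Q \<ge> 2"
    and "homogeneous_quasi_norm Exp A N"
    and "haar_measure M"
    and "1 < p" and "p < Q" and "1 / p + 1 / q = 1"
    and "f \<in> test_functions_off_zero \<A>"
  shows "(\<integral>x. cmod (radial_derivative Exp A N f x) powr p \<partial>M) powr (1 / p)
           * (\<integral>x. N x powr q * cmod (f x) powr q \<partial>M) powr (1 / q)
         \<ge> (Q - p) / p * (\<integral>x. (cmod (f x))\<^sup>2 \<partial>M)"
  using homogeneous_group.hardy_uncertainty_inequality[of \<A> c Exp A f N M p q] assms by simp

end
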